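(* For the Monotone bandits problem, the BalancedIndex policy defined in the context is a $2$-approximation: its time-average expected reward is at least half the value of an optimal policy.
   Context: Monotone bandits: there are $n$ arms; arm $i$ has a finite state set $\mathcal S_i$. At each time step a policy plays at most one arm. An arm that is not played stays in its state and yields no reward. If arm $i$ is in state $k\in\mathcal S_i$ and is played, where $t\ge1$ is the number of steps since arm $i$ was last played, it yields reward $r^i_k\ge0$ and then moves to state $j\ne k$ with probability $f^i_k(t)q^i(k,j)$, staying in $k$ with the remaining probability; different arms transition independently. Separability: $q^i(k,j)\ge0$ and $\sum_{j\ne k}q^i(k,j)\le1$. Monotonicity: $f^i_k:\{1,2,\dots\}\to[0,1]$ satisfies $f^i_k(t)\le f^i_k(t+1)$. Each $f^i_k$ is piecewise linear, given by a polynomial-size breakpoint set $\mathcal W^i_k=\{t_1=1<t_2<\dots<t_m\}$ with specified values, linear interpolation between consecutive breakpoints, and $f^i_k(t)=f^i_k(t_m)$ for $t\ge t_m$. For each $i$ the directed graph on $\mathcal S_i$ with an edge $(j,k)$ whenever $q^i(j,k)>0$ is strongly connected. The policy may choose the starting state of each arm; the value of a policy is its infinite-horizon time-average expected reward. LP (Balance), with variables $\lambda$, $h_i$ and free variables $p^i_k$, writing $\Delta P^i_k=\sum_{j\in\mathcal S_i,j\ne k}q^i(k,j)(p^i_j-p^i_k)$: minimize $\lambda+\sum_ih_i$ subject to $\lambda+th_i\ge r^i_k+f^i_k(t)\Delta P^i_k$ for all $i$, $k\in\mathcal S_i$, $t\in\mathcal W^i_k$; $\lambda=\sum_ih_i$;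 $\lambda,h_i\ge0$. BalancedIndex policy: take an optimal solution of (Balance). Case A: if for some arm $i$ with $h_i>0$ and some state $k\in\mathcal S_i$ none of the constraints $\lambda+th_i\ge r^i_k+f^i_k(t)\Delta P^i_k$, $t\in\mathcal W^i_k$, is tight, the policy repeatedly plays a single arm (from a chosen starting state) forever, namely an arm and starting state for which repeated play gives per-step reward at least $\lambda+h_i$. Case B (otherwise): discard arms with $h_i=0$. For each remaining arm $i$ and $k\in\mathcal S_i$ let $t^i_k$ be the smallest $t\in\mathcal W^i_k$ with $\lambda+th_i=r^i_k+f^i_k(t)\Delta P^i_k$. Let $\mathcal G_i=\{k:\Delta P^i_k<0\}$ and $\mathcal I_i=\mathcal S_i\setminus\mathcal G_i$. An arm $i$ in state $k\in\mathcal I_i$ is "ready" once at least $t^i_k$ steps have elapsed since it was last played. The policy: (1) Exploit: if some arm $i$ moves to a state in $\mathcal G_i$, play it exclusively as long as its state stays in $\mathcal G_i$; (2) Explore: otherwise play any ready arm $i$ in a state of $\mathcal I_i$ (if none is ready, do not play at this step); if the played arm moves into $\mathcal G_i$ go to (1), else repeat (2). *)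

theory Defs
  imports "HOL-Probability.Probability"
begin

text \<open>
  A bandit instance. Arms are \<open>0, ..., narms - 1\<close>; the functions are only meaningful
  for arms below \<open>narms\<close>, states in \<open>states i\<close> and elapsed times \<open>t \<ge> 1\<close>.
  \<open>ffun i k t\<close> is $f^i_k(t)$, \<open>qfun i k j\<close> is $q^i(k,j)$ and \<open>brk i k\<close> is the set of
  breakpoints $W^i_k$.
\<close>

record 's bandit =
  narms :: nat
  states :: "nat \<Rightarrow> 's set"
  rew :: "nat \<Rightarrow> 's \<Rightarrow> real"
  ffun :: "nat \<Rightarrow> 's \<Rightarrow> nat \<Rightarrow> real"
  qfun :: "nat \<Rightarrow> 's \<Rightarrow> 's \<Rightarrow> real"
  brk :: "nat \<Rightarrow> 's \<Rightarrow> nat set"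

definition piecewise_linear_on :: "nat set \<Rightarrow> (nat \<Rightarrow> real) \<Rightarrow> bool" where
  "piecewise_linear_on W g \<longleftrightarrow>
     finite W \<and> 1 \<in> W \<and> (\<forall>t\<in>W. 1 \<le> t) \<and>
     (\<forall>a\<in>W. \<forall>b\<in>W. a < b \<and> {a<..<b} \<inter> W = {} \<longrightarrow>
        (\<forall>t\<in>{a..b}. g t = g a + (g b - g a) * (real t - real a) / (real b - real a))) \<and>
     (\<forall>t\<ge>Max W. g t = g (Max W))"

definition strongly_connected :: "'s set \<Rightarrow> ('s \<Rightarrow> 's \<Rightarrow> real) \<Rightarrow> bool" where
  "strongly_connected V w \<longleftrightarrow>
     (\<forall>j\<in>V. \<forall>k\<in>V. (j, k) \<in> {(a, b). a \<in> V \<and> b \<in> V \<and> w a b > 0}\<^sup>*)"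

definition monotone_bandit :: "'s bandit \<Rightarrow> bool" where
  "monotone_bandit B \<longleftrightarrow> (\<forall>i<narms B.
     finite (states B i) \<and> states B i \<noteq> {} \<and>
     strongly_connected (states B i) (qfun B i) \<and>
     (\<forall>k\<in>states B i.
        0 \<le> rew B i k \<and>
        (\<forall>j\<in>states B i - {k}. 0 \<le> qfun B i k j) \<and>
        (\<Sum>j\<in>states B i - {k}. qfun B i k j) \<le> 1 \<and>
        (\<forall>t\<ge>1. 0 \<le> ffun B i k t \<and> ffun B i k t \<le> 1 \<and> ffun B i k t \<le> ffun B i k (t + 1)) \<and>
        piecewise_linear_on (brk B i k) (ffun B i k)))"

text \<open>
  A configuration records the current state of each arm and, for each arm, the number of steps
  since it was last played. A decision is \<open>Some i\<close> (play arm \<open>i\<close>) or \<open>None\<close> (play no arm).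
  A history lists the past configurations with the decisions taken in them, most recent first.
\<close>

type_synonym 's config = "(nat \<Rightarrow> 's) \<times> (nat \<Rightarrow> nat)"
type_synonym 's history = "('s config \<times> nat option) list"

definition move :: "'s bandit \<Rightarrow> nat \<Rightarrow> 's \<Rightarrow> nat \<Rightarrow> 's pmf" where
  "move B i k t = embed_pmf (\<lambda>j.
     if j = k then 1 - (\<Sum>l\<in>states B i - {k}. ffun B i k t * qfun B i k l)
     else if j \<in> states B i then ffun B i k t * qfun B i k j
     else 0)"

fun step :: "'s bandit \<Rightarrow> 's config \<Rightarrow> nat option \<Rightarrow> 's config pmf" where
  "step B (s, \<tau>) None = return_pmf (s, \<lambda>l. \<tau> l + 1)"
| "step B (s, \<tau>) (Some i) =
     map_pmf (\<lambda>j. (s(i := j), (\<lambda>l. \<tau> l + 1)(i := 1))) (move B i (s i) (\<tau> i))"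

fun step_reward :: "'s bandit \<Rightarrow> 's config \<times> nat option \<Rightarrow> real" where
  "step_reward B ((s, \<tau>), None) = 0"
| "step_reward B ((s, \<tau>), Some i) = rew B i (s i)"

text \<open>
  Policies are history dependent and may randomize; they also choose the starting states.
\<close>

record 's policy =
  start :: "nat \<Rightarrow> 's"
  act :: "'s history \<Rightarrow> 's config \<Rightarrow> nat option pmf"

definition policies :: "'s bandit \<Rightarrow> 's policy set" where
  "policies B = {\<pi>. (\<forall>i<narms B. start \<pi> i \<in> states B i) \<and>
     (\<forall>H c. set_pmf (act \<pi> H c) \<subseteq> insert None (Some ` {..<narms B}))}"

text \<open>
  The law of the history and current configuration after \<open>T\<close> steps. No arm has been played
  before the first step; the elapsed times start at \<open>1\<close> by convention.
\<close>

primrec run :: "'s bandit \<Rightarrow> 's policy \<Rightarrow> nat \<Rightarrow> ('s history \<times> 's config) pmf" where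
  "run B \<pi> 0 = return_pmf ([], (start \<pi>, \<lambda>_. 1))"
| "run B \<pi> (Suc T) =
     bind_pmf (run B \<pi> T) (\<lambda>(H, c).
     bind_pmf (act \<pi> H c) (\<lambda>a.
     map_pmf (\<lambda>c'. ((c, a) # H, c')) (step B c a)))"

definition mean_reward :: "'s bandit \<Rightarrow> 's policy \<Rightarrow> nat \<Rightarrow> real" where
  "mean_reward B \<pi> T =
     measure_pmf.expectation (run B \<pi> T) (\<lambda>(H, c). \<Sum>x\<leftarrow>H. step_reward B x) / real T"

text \<open>
  The time average of a history-dependent policy need not converge. Guarantees are stated for
  the lower average and the optimum is taken over upper averages, so that a bound of the optimum
  by a guarantee holds under either convention for the value of a policy.
\<close>

definition avg_reward_lower :: "'s bandit \<Rightarrow> 's policy \<Rightarrow> ereal" where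
  "avg_reward_lower B \<pi> = liminf (\<lambda>T. ereal (mean_reward B \<pi> T))"

definition avg_reward_upper :: "'s bandit \<Rightarrow> 's policy \<Rightarrow> ereal" where
  "avg_reward_upper B \<pi> = limsup (\<lambda>T. ereal (mean_reward B \<pi> T))"

definition opt_value :: "'s bandit \<Rightarrow> ereal" where
  "opt_value B = (SUP \<pi>\<in>policies B. avg_reward_upper B \<pi>)"

definition DeltaP :: "'s bandit \<Rightarrow> (nat \<Rightarrow> 's \<Rightarrow> real) \<Rightarrow> nat \<Rightarrow> 's \<Rightarrow> real" where
  "DeltaP B p i k = (\<Sum>j\<in>states B i - {k}. qfun B i k j * (p i j - p i k))"

definition balance_feasible ::
    "'s bandit \<Rightarrow> real \<Rightarrow> (nat \<Rightarrow> real) \<Rightarrow> (nat \<Rightarrow> 's \<Rightarrow> real) \<Rightarrow> bool" where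
  "balance_feasible B lam h p \<longleftrightarrow>
     (\<forall>i<narms B. \<forall>k\<in>states B i. \<forall>t\<in>brk B i k.
        lam + real t * h i \<ge> rew B i k + ffun B i k t * DeltaP B p i k) \<and>
     lam = (\<Sum>i<narms B. h i) \<and> lam \<ge> 0 \<and> (\<forall>i<narms B. h i \<ge> 0)"

definition balance_optimal ::
    "'s bandit \<Rightarrow> real \<Rightarrow> (nat \<Rightarrow> real) \<Rightarrow> (nat \<Rightarrow> 's \<Rightarrow> real) \<Rightarrow> bool" where
  "balance_optimal B lam h p \<longleftrightarrow> balance_feasible B lam h p \<and>
     (\<forall>lam' h' p'. balance_feasible B lam' h' p' \<longrightarrow>
        lam + (\<Sum>i<narms B. h i) \<le> lam' + (\<Sum>i<narms B. h' i))"

definition tight ::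
    "'s bandit \<Rightarrow> real \<Rightarrow> (nat \<Rightarrow> real) \<Rightarrow> (nat \<Rightarrow> 's \<Rightarrow> real) \<Rightarrow> nat \<Rightarrow> 's \<Rightarrow> nat \<Rightarrow> bool" where
  "tight B lam h p i k t \<longleftrightarrow>
     lam + real t * h i = rew B i k + ffun B i k t * DeltaP B p i k"

definition untight_arm ::
    "'s bandit \<Rightarrow> real \<Rightarrow> (nat \<Rightarrow> real) \<Rightarrow> (nat \<Rightarrow> 's \<Rightarrow> real) \<Rightarrow> nat \<Rightarrow> bool" where
  "untight_arm B lam h p i \<longleftrightarrow> i < narms B \<and> h i > 0 \<and>
     (\<exists>k\<in>states B i. \<forall>t\<in>brk B i k. \<not> tight B lam h p i k t)"

definition remaining_arms :: "'s bandit \<Rightarrow> (nat \<Rightarrow> real) \<Rightarrow> nat set" where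
  "remaining_arms B h = {i. i < narms B \<and> h i > 0}"

definition wait_time ::
    "'s bandit \<Rightarrow> real \<Rightarrow> (nat \<Rightarrow> real) \<Rightarrow> (nat \<Rightarrow> 's \<Rightarrow> real) \<Rightarrow> nat \<Rightarrow> 's \<Rightarrow> nat" where
  "wait_time B lam h p i k = (LEAST t. t \<in> brk B i k \<and> tight B lam h p i k t)"

definition good_states :: "'s bandit \<Rightarrow> (nat \<Rightarrow> 's \<Rightarrow> real) \<Rightarrow> nat \<Rightarrow> 's set" where
  "good_states B p i = {k \<in> states B i. DeltaP B p i k < 0}"

definition bad_states :: "'s bandit \<Rightarrow> (nat \<Rightarrow> 's \<Rightarrow> real) \<Rightarrow> nat \<Rightarrow> 's set" where
  "bad_states B p i = states B i - good_states B p i"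

definition ready_arms ::
    "'s bandit \<Rightarrow> real \<Rightarrow> (nat \<Rightarrow> real) \<Rightarrow> (nat \<Rightarrow> 's \<Rightarrow> real) \<Rightarrow> 's config \<Rightarrow> nat set" where
  "ready_arms B lam h p c = {i \<in> remaining_arms B h.
     fst c i \<in> bad_states B p i \<and> wait_time B lam h p i (fst c i) \<le> snd c i}"

definition exploitable_arms ::
    "'s bandit \<Rightarrow> (nat \<Rightarrow> real) \<Rightarrow> (nat \<Rightarrow> 's \<Rightarrow> real) \<Rightarrow> 's config \<Rightarrow> nat set" where
  "exploitable_arms B h p c = {i \<in> remaining_arms B h. fst c i \<in> good_states B p i}"

fun last_played :: "'s history \<Rightarrow> nat set" where
  "last_played ((c, Some i) # H) = {i}"
| "last_played _ = {}"

text \<open>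
  The decisions allowed by the exploit/explore rule. An arm being exploited is the one played in
  the previous step. The second branch only concerns arms that start in a good state: these are
  treated as if they had just moved there, and are exploited one after the other.
\<close>

definition index_choices ::
    "'s bandit \<Rightarrow> real \<Rightarrow> (nat \<Rightarrow> real) \<Rightarrow> (nat \<Rightarrow> 's \<Rightarrow> real) \<Rightarrow>
     's history \<Rightarrow> 's config \<Rightarrow> nat option set" where
  "index_choices B lam h p H c =
     (if last_played H \<inter> exploitable_arms B h p c \<noteq> {}
        then Some ` (last_played H \<inter> exploitable_arms B h p c)
      else if exploitable_arms B h p c \<noteq> {} then Some ` exploitable_arms B h p c
      else if ready_arms B lam h p c \<noteq> {} then Some ` ready_arms B lam h p c
      else {None})"

text \<open>
  The choices left open by the description (starting states, which ready arm to explore, which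
  rewarding single arm to play) are arbitrary, so this is a predicate on policies.
\<close>

definition balanced_index ::
    "'s bandit \<Rightarrow> real \<Rightarrow> (nat \<Rightarrow> real) \<Rightarrow> (nat \<Rightarrow> 's \<Rightarrow> real) \<Rightarrow> 's policy \<Rightarrow> bool" where
  "balanced_index B lam h p \<pi> \<longleftrightarrow> \<pi> \<in> policies B \<and>
     (if \<exists>i. untight_arm B lam h p i
      then (\<exists>i a. untight_arm B lam h p i \<and> a < narms B \<and>
              (\<forall>H c. act \<pi> H c = return_pmf (Some a)) \<and>
              avg_reward_lower B \<pi> \<ge> ereal (lam + h i))
      else (\<forall>H c. set_pmf (act \<pi> H c) \<subseteq> index_choices B lam h p H c))"

end

theory Submission imports Defs begin

text \<open>
  Weak duality: for a feasible \<open>(lam, h, p)\<close>, the potential that adds \<open>p i s\<^sub>i + h i \<tau>\<^sub>i\<close> over the arms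
  compensates the reward of a step up to \<open>lam + (\<Sum>i. h i) = 2 * lam\<close>, so no policy earns
  more than \<open>2 * lam\<close> per step.

  Conversely the index policy earns at least \<open>lam\<close> per step. If an arm has a state without tight
  constraint, lowering \<open>p\<close> backwards along the edges of the arm would make all its constraints slack
  and the solution improvable, unless some state \<open>j\<close> of the arm has \<open>f j 1 = 0\<close> and reward
  \<open>lam + h i\<close>; playing the arm from \<open>j\<close> forever then earns this reward in each step. Otherwise the
  same potential is used with the waiting time \<open>\<tau>\<^sub>i\<close> cut off at the moment the arm becomes ready:
  idling increases it by \<open>(\<Sum>i. h i) = lam\<close>, and playing a ready or an exploited arm gains at least
  \<open>lam\<close> by tightness.
\<close>

subsection \<open>Expected drift along a run\<close>

lemma monotone_banditD:
  assumes "monotone_bandit B" "i < narms B"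
  shows "finite (states B i)" "states B i \<noteq> {}"
    "strongly_connected (states B i) (qfun B i)"
    and "k \<in> states B i \<Longrightarrow> 0 \<le> rew B i k"
    and "k \<in> states B i \<Longrightarrow> j \<in> states B i - {k} \<Longrightarrow> 0 \<le> qfun B i k j"
    and "k \<in> states B i \<Longrightarrow> (\<Sum>j\<in>states B i - {k}. qfun B i k j) \<le> 1"
    and "k \<in> states B i \<Longrightarrow> 1 \<le> t \<Longrightarrow> 0 \<le> ffun B i k t"
    and "k \<in> states B i \<Longrightarrow> 1 \<le> t \<Longrightarrow> ffun B i k t \<le> 1"
    and "k \<in> states B i \<Longrightarrow> piecewise_linear_on (brk B i k) (ffun B i k)"
  using assms unfolding monotone_bandit_def by blast+

lemma ffun_mono:
  assumes "monotone_bandit B" "i < narms B" "k \<in> states B i" "1 \<le> u" "u \<le> t"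
  shows "ffun B i k u \<le> ffun B i k t"
  using assms(5)
proof (induction t rule: dec_induct)
  case (step t)
  then have "ffun B i k t \<le> ffun B i k (t + 1)"
    using assms unfolding monotone_bandit_def by auto
  then show ?case using step by simp
qed simp

lemma brkD:
  assumes "monotone_bandit B" "i < narms B" "k \<in> states B i"
  shows "finite (brk B i k)" "1 \<in> brk B i k" "t \<in> brk B i k \<Longrightarrow> 1 \<le> t"
  using monotone_banditD(9)[OF assms] unfolding piecewise_linear_on_def by auto

text \<open>\<open>embed_pmf\<close> is meaningful only for nonnegative weights of total mass 1.
  Staying put is defined as the complement of the other weights, and it is nonnegative because
  \<open>f\<close> and the total of \<open>q\<close> are at most 1.\<close>

lemma pmf_move:
  assumes "monotone_bandit B" "i < narms B" "k \<in> states B i" "1 \<le> t"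
  shows "pmf (move B i k t) j =
     (if j = k then 1 - (\<Sum>l\<in>states B i - {k}. ffun B i k t * qfun B i k l)
     else if j \<in> states B i then ffun B i k t * qfun B i k j
     else 0)"
proof -
  let ?S = "states B i" and ?f = "ffun B i k t" and ?q = "qfun B i k"
  let ?g = "\<lambda>j. if j = k then 1 - (\<Sum>l\<in>?S - {k}. ?f * ?q l)
     else if j \<in> ?S then ?f * ?q j else 0"
  have f: "0 \<le> ?f" "?f \<le> 1" using monotone_banditD[OF assms(1,2)] assms(3,4) by auto
  have q: "0 \<le> ?q l" if "l \<in> ?S - {k}" for l
    using monotone_banditD(5)[OF assms(1-3)] that by auto
  have fin: "finite ?S" using monotone_banditD[OF assms(1,2)] by auto
  have "(\<Sum>l\<in>?S - {k}. ?f * ?q l) = ?f * (\<Sum>l\<in>?S - {k}. ?q l)" by (simp add: sum_distrib_left)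
  also have "\<dots> \<le> 1"
    using f monotone_banditD(6)[OF assms(1-3)] sum_nonneg[of "?S - {k}" ?q] q by (intro mult_le_one) auto
  finally have s: "(\<Sum>l\<in>?S - {k}. ?f * ?q l) \<le> 1" .
  have nn: "0 \<le> ?g x" for x using f q s by auto
  have "(\<Sum>x\<in>?S. ?g x) = ?g k + (\<Sum>x\<in>?S - {k}. ?g x)"
    using fin assms(3) by (rule sum.remove)
  also have "(\<Sum>x\<in>?S - {k}. ?g x) = (\<Sum>l\<in>?S - {k}. ?f * ?q l)"
    by (intro sum.cong) auto
  finally have sum1: "(\<Sum>x\<in>?S. ?g x) = 1" by simp
  have "(\<integral>\<^sup>+x. ennreal (?g x) \<partial>count_space UNIV) = (\<Sum>x\<in>?S. ennreal (?g x))"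
    using fin assms(3) by (intro nn_integral_count_space') auto
  also have "\<dots> = ennreal (\<Sum>x\<in>?S. ?g x)" using nn by (intro sum_ennreal) blast
  finally have "(\<integral>\<^sup>+x. ennreal (?g x) \<partial>count_space UNIV) = 1" using sum1 by simp
  from pmf_embed_pmf[of ?g, OF nn this] show ?thesis unfolding move_def by simp
qed

lemma set_pmf_move:
  assumes "monotone_bandit B" "i < narms B" "k \<in> states B i" "1 \<le> t"
  shows "set_pmf (move B i k t) \<subseteq> states B i"
  using assms by (auto simp: set_pmf_eq pmf_move)

lemma expectation_move:
  assumes "monotone_bandit B" "i < narms B" "k \<in> states B i" "1 \<le> t"
  shows "measure_pmf.expectation (move B i k t) F =
    F k + ffun B i k t * (\<Sum>j\<in>states B i - {k}. qfun B i k j * (F j - F k))"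
proof -
  let ?S = "states B i" and ?f = "ffun B i k t" and ?q = "qfun B i k"
  have fin: "finite ?S" using monotone_banditD[OF assms(1,2)] by auto
  have "measure_pmf.expectation (move B i k t) F = (\<Sum>j\<in>?S. F j * pmf (move B i k t) j)"
    using set_pmf_move[OF assms] fin by (intro integral_measure_pmf_real) auto
  also have "\<dots> = F k * pmf (move B i k t) k + (\<Sum>j\<in>?S - {k}. F j * pmf (move B i k t) j)"
    using fin assms(3) by (rule sum.remove)
  also have "(\<Sum>j\<in>?S - {k}. F j * pmf (move B i k t) j) = (\<Sum>j\<in>?S - {k}. ?f * (?q j * F j))"
    by (intro sum.cong) (auto simp: pmf_move[OF assms])
  finally show ?thesis
    by (simp add: pmf_move[OF assms] sum_distrib_left sum_distrib_right sum_subtractf algebra_simps)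
qed

text \<open>Serves both potentials below: each splits over the arms, so playing arm \<open>i\<close>
  affects it randomly only through \<open>p i j\<close>, and \<open>C\<close> collects the
  deterministic rest.\<close>

lemma expectation_step_play:
  assumes "monotone_bandit B" "i < narms B" "s i \<in> states B i" "1 \<le> \<tau> i"
    and G: "\<And>j. j \<in> states B i \<Longrightarrow> G (s(i := j), (\<lambda>l. \<tau> l + 1)(i := 1)) = p i j + C"
  shows "measure_pmf.expectation (step B (s, \<tau>) (Some i)) G =
    p i (s i) + ffun B i (s i) (\<tau> i) * DeltaP B p i (s i) + C"
  using G[OF assms(3)] G unfolding DeltaP_def
  by (simp add: expectation_move[OF assms(1-4)])

section \<open>Reachable configurations and finiteness of supports\<close>

definition valid_config :: "'s bandit \<Rightarrow> 's config \<Rightarrow> bool" where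
  "valid_config B c \<longleftrightarrow> (\<forall>i<narms B. fst c i \<in> states B i) \<and> (\<forall>i. 1 \<le> snd c i)"

lemma policiesD:
  assumes "\<pi> \<in> policies B" "a \<in> set_pmf (act \<pi> H c)"
  shows "a = None \<or> (\<exists>i<narms B. a = Some i)"
  using assms unfolding policies_def by blast

lemma finite_set_act:
  assumes "\<pi> \<in> policies B"
  shows "finite (set_pmf (act \<pi> H c))"
proof (rule finite_subset)
  show "set_pmf (act \<pi> H c) \<subseteq> insert None (Some ` {..<narms B})"
    using assms unfolding policies_def by blast
qed simp

lemma valid_config_step:
  assumes "monotone_bandit B" "\<pi> \<in> policies B" "valid_config B c"
    "a \<in> set_pmf (act \<pi> H c)" "c' \<in> set_pmf (step B c a)"
  shows "valid_config B c'"
proof -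
  obtain s \<tau> where c: "c = (s, \<tau>)" by (cases c)
  show ?thesis
    using policiesD[OF assms(2,4)] assms(3,5) set_pmf_move[OF assms(1)]
    by (fastforce simp: c valid_config_def)
qed

lemma run_induct [consumes 3, case_names start step]:
  assumes B: "monotone_bandit B" and \<pi>: "\<pi> \<in> policies B" and "(H, c) \<in> set_pmf (run B \<pi> T)"
    and start: "P 0 [] (start \<pi>, \<lambda>_. 1)"
    and step: "\<And>T H c a c'. (H, c) \<in> set_pmf (run B \<pi> T) \<Longrightarrow> P T H c \<Longrightarrow> valid_config B c \<Longrightarrow>
      a \<in> set_pmf (act \<pi> H c) \<Longrightarrow> c' \<in> set_pmf (step B c a) \<Longrightarrow> P (Suc T) ((c, a) # H) c'"
  shows "valid_config B c \<and> P T H c"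
  using assms(3)
proof (induction T arbitrary: H c)
  case 0
  then show ?case using \<pi> start by (auto simp: valid_config_def policies_def)
next
  case (Suc T)
  then obtain H' c' a where *: "(H', c') \<in> set_pmf (run B \<pi> T)"
    "a \<in> set_pmf (act \<pi> H' c')" "c \<in> set_pmf (step B c' a)" "H = (c', a) # H'"
    by (auto simp: set_bind_pmf)
  with Suc.IH[OF *(1)] show ?case
    using valid_config_step[OF B \<pi>] step by blast
qed

lemmas run_valid_config =
  run_induct[where P = "\<lambda>_ _ _. True", simplified]

lemma finite_set_step:
  assumes "monotone_bandit B" "\<pi> \<in> policies B" "valid_config B c" "a \<in> set_pmf (act \<pi> H c)"
  shows "finite (set_pmf (step B c a))"
proof -
  obtain s \<tau> where c: "c = (s, \<tau>)" by (cases c)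
  show ?thesis
    using policiesD[OF assms(2,4)] assms(3) finite_subset[OF set_pmf_move[OF assms(1)] monotone_banditD(1)[OF assms(1)]]
    by (auto simp: c valid_config_def)
qed

lemma finite_set_run:
  assumes "monotone_bandit B" "\<pi> \<in> policies B"
  shows "finite (set_pmf (run B \<pi> T))"
proof (induction T)
  case (Suc T)
  then show ?case
    using finite_set_act[OF assms(2)] finite_set_step[OF assms run_valid_config[OF assms]]
    by (auto simp: set_bind_pmf split: prod.split)
qed simp

text \<open>The tower rule for one more step. All supports are finite, so expectations are finite
  sums and no integrability condition on \<open>F\<close> remains.\<close>

lemma expectation_run_Suc:
  fixes F :: "'s history \<times> 's config \<Rightarrow> real"
  assumes "monotone_bandit B" "\<pi> \<in> policies B"
  shows "measure_pmf.expectation (run B \<pi> (Suc T)) F =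
    measure_pmf.expectation (run B \<pi> T) (\<lambda>(H, c).
      measure_pmf.expectation (act \<pi> H c) (\<lambda>a.
        measure_pmf.expectation (step B c a) (\<lambda>c'. F ((c, a) # H, c'))))"
proof -
  let ?K = "\<lambda>(H, c). bind_pmf (act \<pi> H c) (\<lambda>a. map_pmf (\<lambda>c'. ((c, a) # H, c')) (step B c a))"
  let ?R = "set_pmf (run B \<pi> T)"
  have fin: "finite (set_pmf (?K x))" if "x \<in> ?R" for x
    using that finite_set_act[OF assms(2)] finite_set_step[OF assms run_valid_config[OF assms]]
    by (cases x) (auto simp: set_bind_pmf)
  have E: "measure_pmf.expectation (?K (H, c)) F =
      measure_pmf.expectation (act \<pi> H c) (\<lambda>a.
        measure_pmf.expectation (step B c a) (\<lambda>c'. F ((c, a) # H, c')))"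
    if "(H, c) \<in> ?R" for H c
  proof -
    have v: "valid_config B c" using run_valid_config[OF assms that] .
    have "measure_pmf.expectation (?K (H, c)) F = (\<Sum>a\<in>set_pmf (act \<pi> H c). pmf (act \<pi> H c) a *\<^sub>R
       measure_pmf.expectation (map_pmf (\<lambda>c'. ((c, a) # H, c')) (step B c a)) F)"
      using finite_set_act[OF assms(2)] finite_set_step[OF assms v]
      by (simp add: pmf_expectation_bind[of "set_pmf (act \<pi> H c)"])
    also have "\<dots> = measure_pmf.expectation (act \<pi> H c) (\<lambda>a.
        measure_pmf.expectation (step B c a) (\<lambda>c'. F ((c, a) # H, c')))"
      using finite_set_act[OF assms(2)] by (subst integral_measure_pmf[where A = "set_pmf (act \<pi> H c)"]) auto
    finally show ?thesis .
  qed
  have "measure_pmf.expectation (run B \<pi> (Suc T)) F =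
      (\<Sum>x\<in>?R. pmf (run B \<pi> T) x *\<^sub>R measure_pmf.expectation (?K x) F)"
    unfolding run.simps using finite_set_run[OF assms] fin by (intro pmf_expectation_bind) auto
  also have "\<dots> = (\<Sum>x\<in>?R. pmf (run B \<pi> T) x *\<^sub>R (case x of (H, c) \<Rightarrow>
      measure_pmf.expectation (act \<pi> H c) (\<lambda>a.
        measure_pmf.expectation (step B c a) (\<lambda>c'. F ((c, a) # H, c')))))"
    using E by (intro sum.cong refl) (auto split: prod.splits)
  also have "\<dots> = measure_pmf.expectation (run B \<pi> T) (\<lambda>(H, c).
      measure_pmf.expectation (act \<pi> H c) (\<lambda>a.
        measure_pmf.expectation (step B c a) (\<lambda>c'. F ((c, a) # H, c'))))"
    using finite_set_run[OF assms] by (subst integral_measure_pmf[where A = ?R]) auto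
  finally show ?thesis .
qed

section \<open>From drift inequalities to time averages\<close>

lemma expectation_mono_finite:
  fixes F G :: "'a \<Rightarrow> real"
  assumes "finite (set_pmf p)" "\<And>x. x \<in> set_pmf p \<Longrightarrow> F x \<le> G x"
  shows "measure_pmf.expectation p F \<le> measure_pmf.expectation p G"
  using assms by (intro integral_mono_AE) (auto simp: integrable_measure_pmf_finite AE_measure_pmf_iff)

text \<open>The drift bounds telescope over time. The potential may depend on the history, which the
  index policy needs, and \<open>R\<close> is arbitrary so that negated rewards can be
  inserted.\<close>

lemma run_drift_le:
  assumes B: "monotone_bandit B" and \<pi>: "\<pi> \<in> policies B"
    and drift: "\<And>T H c a. (H, c) \<in> set_pmf (run B \<pi> T) \<Longrightarrow> a \<in> set_pmf (act \<pi> H c) \<Longrightarrow>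
      R (c, a) + measure_pmf.expectation (step B c a) (\<Phi> ((c, a) # H)) \<le> \<Phi> H c + g"
  shows "measure_pmf.expectation (run B \<pi> T) (\<lambda>(H, c). (\<Sum>x\<leftarrow>H. R x) + \<Phi> H c) \<le>
    \<Phi> [] (start \<pi>, \<lambda>_. 1) + real T * g"
proof (induction T)
  case (Suc T)
  let ?E = measure_pmf.expectation
  have "?E (act \<pi> H c) (\<lambda>a. ?E (step B c a) (\<lambda>c'. (\<Sum>x\<leftarrow>(c, a) # H. R x) + \<Phi> ((c, a) # H) c'))
      \<le> ((\<Sum>x\<leftarrow>H. R x) + \<Phi> H c) + g" if HC: "(H, c) \<in> set_pmf (run B \<pi> T)" for H c
  proof -
    have "?E (step B c a) (\<lambda>c'. (\<Sum>x\<leftarrow>(c, a) # H. R x) + \<Phi> ((c, a) # H) c')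
      \<le> (\<Sum>x\<leftarrow>H. R x) + \<Phi> H c + g" if a: "a \<in> set_pmf (act \<pi> H c)" for a
    proof -
      have "?E (step B c a) (\<lambda>c'. (\<Sum>x\<leftarrow>(c, a) # H. R x) + \<Phi> ((c, a) # H) c') =
          (\<Sum>x\<leftarrow>(c, a) # H. R x) + ?E (step B c a) (\<Phi> ((c, a) # H))"
        using finite_set_step[OF B \<pi> run_valid_config[OF B \<pi> HC] a]
        by (subst Bochner_Integration.integral_add) (auto simp: integrable_measure_pmf_finite)
      then show ?thesis using drift[OF HC a] by simp
    qed
    then have "?E (act \<pi> H c) (\<lambda>a. ?E (step B c a) (\<lambda>c'. (\<Sum>x\<leftarrow>(c, a) # H. R x) + \<Phi> ((c, a) # H) c'))
       \<le> ?E (act \<pi> H c) (\<lambda>_. (\<Sum>x\<leftarrow>H. R x) + \<Phi> H c + g)"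
      using finite_set_act[OF \<pi>] by (intro expectation_mono_finite) auto
    then show ?thesis by simp
  qed
  then have "?E (run B \<pi> (Suc T)) (\<lambda>(H, c). (\<Sum>x\<leftarrow>H. R x) + \<Phi> H c) \<le>
      ?E (run B \<pi> T) (\<lambda>(H, c). ((\<Sum>x\<leftarrow>H. R x) + \<Phi> H c) + g)"
    unfolding expectation_run_Suc[OF B \<pi>] using finite_set_run[OF B \<pi>]
    by (intro expectation_mono_finite) auto
  also have "\<dots> = ?E (run B \<pi> T) (\<lambda>x. (case x of (H, c) \<Rightarrow> (\<Sum>x\<leftarrow>H. R x) + \<Phi> H c) + g)"
    by (simp add: case_prod_unfold)
  also have "\<dots> = ?E (run B \<pi> T) (\<lambda>(H, c). (\<Sum>x\<leftarrow>H. R x) + \<Phi> H c) + g"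
    using finite_set_run[OF B \<pi>]
    by (subst Bochner_Integration.integral_add) (auto simp: integrable_measure_pmf_finite)
  finally show ?case using Suc by (simp add: algebra_simps)
qed simp

text \<open>A lower bound on the potential lets it be dropped at a cost independent of
  \<open>T\<close>, which vanishes in the time average.\<close>

lemma run_reward_le:
  assumes B: "monotone_bandit B" and \<pi>: "\<pi> \<in> policies B"
    and drift: "\<And>T H c a. (H, c) \<in> set_pmf (run B \<pi> T) \<Longrightarrow> a \<in> set_pmf (act \<pi> H c) \<Longrightarrow>
      R (c, a) + measure_pmf.expectation (step B c a) (\<Phi> ((c, a) # H)) \<le> \<Phi> H c + g"
    and bound: "\<And>T H c. (H, c) \<in> set_pmf (run B \<pi> T) \<Longrightarrow> L \<le> \<Phi> H c"
  shows "measure_pmf.expectation (run B \<pi> T) (\<lambda>(H, c). \<Sum>x\<leftarrow>H. R x) \<le>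
    \<Phi> [] (start \<pi>, \<lambda>_. 1) - L + real T * g"
proof -
  let ?E = "measure_pmf.expectation (run B \<pi> T)"
  have fin: "integrable (measure_pmf (run B \<pi> T)) F" for F :: "_ \<Rightarrow> real"
    using finite_set_run[OF B \<pi>] by (rule integrable_measure_pmf_finite)
  have "?E (\<lambda>(H, c). \<Sum>x\<leftarrow>H. R x) + L = ?E (\<lambda>x. (case x of (H, c) \<Rightarrow> \<Sum>x\<leftarrow>H. R x) + L)"
    by (subst Bochner_Integration.integral_add) (auto intro: fin)
  also have "\<dots> \<le> ?E (\<lambda>(H, c). (\<Sum>x\<leftarrow>H. R x) + \<Phi> H c)"
    using bound finite_set_run[OF B \<pi>] by (intro expectation_mono_finite) auto
  also have "\<dots> \<le> \<Phi> [] (start \<pi>, \<lambda>_. 1) + real T * g" by (rule run_drift_le[OF B \<pi> drift])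
  finally show ?thesis by simp
qed

lemma tendsto_const_plus_over_n: "(\<lambda>T. ereal (g + C / real T)) \<longlonglongrightarrow> ereal g"
proof -
  have "(\<lambda>T. g + C / real T) \<longlonglongrightarrow> g + 0"
    by (intro tendsto_intros lim_const_over_n)
  then show ?thesis by simp
qed

lemma avg_reward_upper_le:
  assumes B: "monotone_bandit B" and \<pi>: "\<pi> \<in> policies B"
    and drift: "\<And>T H c a. (H, c) \<in> set_pmf (run B \<pi> T) \<Longrightarrow> a \<in> set_pmf (act \<pi> H c) \<Longrightarrow>
      step_reward B (c, a) + measure_pmf.expectation (step B c a) (\<Phi> ((c, a) # H)) \<le> \<Phi> H c + g"
    and bound: "\<And>T H c. (H, c) \<in> set_pmf (run B \<pi> T) \<Longrightarrow> L \<le> \<Phi> H c"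
  shows "avg_reward_upper B \<pi> \<le> ereal g"
proof -
  let ?C = "\<Phi> [] (start \<pi>, \<lambda>_. 1) - L"
  have "mean_reward B \<pi> T \<le> g + ?C / real T" if "0 < T" for T
    using run_reward_le[where R = "step_reward B" and \<Phi> = \<Phi> and L = L and g = g and T = T,
        OF B \<pi> drift bound] that
    unfolding mean_reward_def by (simp add: field_simps)
  then have "eventually (\<lambda>T. ereal (mean_reward B \<pi> T) \<le> ereal (g + ?C / real T)) sequentially"
    by (intro eventually_sequentiallyI[of 1]) auto
  from Limsup_mono[OF this] show ?thesis
    unfolding avg_reward_upper_def lim_imp_Limsup[OF _ tendsto_const_plus_over_n, simplified] .
qed

text \<open>Mirror image of the upper bound, obtained by negating rewards and potential; hence the
  potential is here bounded from above.\<close>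

lemma avg_reward_lower_ge:
  assumes B: "monotone_bandit B" and \<pi>: "\<pi> \<in> policies B"
    and drift: "\<And>T H c a. (H, c) \<in> set_pmf (run B \<pi> T) \<Longrightarrow> a \<in> set_pmf (act \<pi> H c) \<Longrightarrow>
      \<Phi> H c + g \<le> step_reward B (c, a) + measure_pmf.expectation (step B c a) (\<Phi> ((c, a) # H))"
    and bound: "\<And>T H c. (H, c) \<in> set_pmf (run B \<pi> T) \<Longrightarrow> \<Phi> H c \<le> M"
  shows "ereal g \<le> avg_reward_lower B \<pi>"
proof -
  let ?C = "\<Phi> [] (start \<pi>, \<lambda>_. 1) - M"
  have "measure_pmf.expectation (run B \<pi> T) (\<lambda>(H, c). \<Sum>x\<leftarrow>H. - step_reward B x) \<le>
    - \<Phi> [] (start \<pi>, \<lambda>_. 1) - (- M) + real T * (- g)" for T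
    using drift bound
    by (intro run_reward_le[where \<Phi> = "\<lambda>H c. - \<Phi> H c", OF B \<pi>]) (auto, smt (verit))
  moreover have "measure_pmf.expectation (run B \<pi> T) (\<lambda>(H, c). \<Sum>x\<leftarrow>H. - step_reward B x) =
     - measure_pmf.expectation (run B \<pi> T) (\<lambda>(H, c). \<Sum>x\<leftarrow>H. step_reward B x)" for T
    by (simp add: case_prod_unfold flip: uminus_sum_list_map[unfolded comp_def])
  ultimately have "mean_reward B \<pi> T \<ge> g + ?C / real T" if "0 < T" for T
    using that unfolding mean_reward_def by (simp add: le_divide_eq distrib_right) (simp add: algebra_simps)
  then have "eventually (\<lambda>T. ereal (g + ?C / real T) \<le> ereal (mean_reward B \<pi> T)) sequentially"
    by (intro eventually_sequentiallyI[of 1]) auto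
  from Liminf_mono[OF this] show ?thesis
    unfolding avg_reward_lower_def lim_imp_Liminf[OF _ tendsto_const_plus_over_n, simplified] .
qed

subsection \<open>Existence of an optimal solution of the linear program\<close>

text \<open>The scalar \<open>z\<close> is kept apart because projection eliminates all of
  \<open>x\<close> and retains \<open>z\<close>. Coefficients live on \<open>V\<close> only,
  although \<open>x\<close> is a total function.\<close>

definition affine_form :: "'v set \<Rightarrow> (real \<Rightarrow> ('v \<Rightarrow> real) \<Rightarrow> real) \<Rightarrow> bool" where
  "affine_form V g \<longleftrightarrow> (\<exists>c b a. \<forall>z x. g z x = c * z + b + (\<Sum>v\<in>V. a v * x v))"

lemma affine_form_const: "affine_form V (\<lambda>z x. b)"
  unfolding affine_form_def by (rule exI[of _ 0], rule exI[of _ b], rule exI[of _ "\<lambda>_. 0"]) simp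

lemma affine_form_fst: "affine_form V (\<lambda>z x. z)"
  unfolding affine_form_def by (rule exI[of _ 1], rule exI[of _ 0], rule exI[of _ "\<lambda>_. 0"]) simp

lemma affine_form_var:
  assumes "finite V" "v \<in> V"
  shows "affine_form V (\<lambda>z x. x v)"
proof -
  have "x v = 0 * z + 0 + (\<Sum>w\<in>V. (if w = v then 1 else 0) * x w)" for z :: real and x :: "'a \<Rightarrow> real"
    using assms by (simp add: if_distrib[of "\<lambda>c. c * _"] cong: if_cong)
  then show ?thesis unfolding affine_form_def
    by (intro exI[of _ 0] exI[of _ "\<lambda>w. if w = v then 1 else 0"]) auto
qed

lemma affine_form_add:
  assumes "affine_form V f" "affine_form V g"
  shows "affine_form V (\<lambda>z x. f z x + g z x)"
proof -
  obtain c b a c' b' a' where "\<And>z x. f z x = c * z + b + (\<Sum>v\<in>V. a v * x v)"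
    "\<And>z x. g z x = c' * z + b' + (\<Sum>v\<in>V. a' v * x v)"
    using assms unfolding affine_form_def by metis
  then have "f z x + g z x = (c + c') * z + (b + b') + (\<Sum>v\<in>V. (a v + a' v) * x v)" for z x
    by (simp add: algebra_simps sum.distrib)
  then show ?thesis unfolding affine_form_def
    by (intro exI[of _ "c + c'"] exI[of _ "b + b'"] exI[of _ "\<lambda>v. a v + a' v"]) auto
qed

lemma affine_form_cmult:
  assumes "affine_form V g"
  shows "affine_form V (\<lambda>z x. r * g z x)"
proof -
  obtain c b a where "\<And>z x. g z x = c * z + b + (\<Sum>v\<in>V. a v * x v)"
    using assms unfolding affine_form_def by metis
  then have "r * g z x = (r * c) * z + r * b + (\<Sum>v\<in>V. (r * a v) * x v)" for z x
    by (simp add: algebra_simps sum_distrib_left)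
  then show ?thesis unfolding affine_form_def
    by (intro exI[of _ "r * c"] exI[of _ "r * b"] exI[of _ "\<lambda>v. r * a v"]) auto
qed

lemma affine_form_diff:
  assumes "affine_form V f" "affine_form V g"
  shows "affine_form V (\<lambda>z x. f z x - g z x)"
  using affine_form_add[OF assms(1) affine_form_cmult[OF assms(2), of "-1"]] by simp

lemma affine_form_sum:
  assumes "\<And>i. i \<in> I \<Longrightarrow> affine_form V (g i)"
  shows "affine_form V (\<lambda>z x. \<Sum>i\<in>I. g i z x)"
  using assms
  by (induction I rule: infinite_finite_induct) (auto intro: affine_form_const affine_form_add)

lemmas affine_form_intros = affine_form_const affine_form_fst affine_form_var
  affine_form_add affine_form_cmult affine_form_diff affine_form_sum

lemma affine_form_upd:
  assumes "affine_form V g" "v \<notin> V"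
  shows "g z (x(v := y)) = g z x"
proof -
  obtain c b a where g: "\<And>z x. g z x = c * z + b + (\<Sum>v\<in>V. a v * x v)"
    using assms unfolding affine_form_def by metis
  have "(\<Sum>w\<in>V. a w * (x(v := y)) w) = (\<Sum>w\<in>V. a w * x w)"
    using assms(2) by (intro sum.cong) auto
  then show ?thesis by (simp add: g)
qed

lemma affine_form_insert:
  assumes "affine_form (insert v V) g" "finite V" "v \<notin> V"
  shows "\<exists>al r. affine_form V r \<and> (\<forall>z x. g z x = al * x v + r z x)"
proof -
  obtain c b a where g: "\<And>z x. g z x = c * z + b + (\<Sum>v\<in>insert v V. a v * x v)"
    using assms unfolding affine_form_def by metis
  show ?thesis
    by (rule exI[of _ "a v"], rule exI[of _ "\<lambda>z x. c * z + b + (\<Sum>v\<in>V. a v * x v)"])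
      (use assms(2,3) in \<open>auto simp: g affine_form_def\<close>)
qed

lemma between_finite_sets:
  fixes L U :: "real set"
  assumes "finite L" "finite U" "\<And>l u. l \<in> L \<Longrightarrow> u \<in> U \<Longrightarrow> l \<le> u"
  shows "\<exists>y. (\<forall>l\<in>L. l \<le> y) \<and> (\<forall>u\<in>U. y \<le> u)"
proof (cases "L = {}")
  case True
  then show ?thesis using assms(2) by (cases "U = {}") (auto intro: exI[of _ "Min U"])
next
  case False
  then show ?thesis using assms by (intro exI[of _ "Max L"]) auto
qed

text \<open>Fourier-Motzkin elimination, one variable at a time.\<close>

lemma closed_projection:
  assumes "finite V" "finite G" "\<And>g. g \<in> G \<Longrightarrow> affine_form V g"
  shows "closed {z. \<exists>x. \<forall>g\<in>G. 0 \<le> g z x}"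
  using assms
proof (induction V arbitrary: G rule: finite_induct)
  case empty
  have *: "g z x = g z (\<lambda>_. 0)" "closed {z. 0 \<le> g z (\<lambda>_. 0)}" if g: "g \<in> G" for g z x
  proof -
    obtain c b where "g = (\<lambda>z x. c * z + b)"
      using empty.prems(2)[OF g] unfolding affine_form_def by fastforce
    then show "g z x = g z (\<lambda>_. 0)" "closed {z. 0 \<le> g z (\<lambda>_. 0)}"
      by (auto intro!: closed_Collect_le continuous_intros)
  qed
  have "(\<exists>x. \<forall>g\<in>G. 0 \<le> g z x) \<longleftrightarrow> (\<forall>g\<in>G. 0 \<le> g z (\<lambda>_. 0))" for z
    using *(1) by metis
  then have "{z. \<exists>x. \<forall>g\<in>G. 0 \<le> g z x} = (\<Inter>g\<in>G. {z. 0 \<le> g z (\<lambda>_. 0)})"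
    by auto
  then show ?case using *(2) by auto
next
  case (insert v V)
  obtain al r where r: "\<And>g. g \<in> G \<Longrightarrow> affine_form V (r g)"
    and al: "\<And>g z x. g \<in> G \<Longrightarrow> g z x = al g * x v + r g z x"
    using affine_form_insert[OF insert.prems(2) insert.hyps] by metis
  define P N where "P = {g\<in>G. 0 < al g}" and "N = {g\<in>G. al g < 0}"
  \<comment> \<open>Forms free of \<open>v\<close> survive. A form \<open>f\<close> bounding
    \<open>x v\<close> from below is paired with a form \<open>g\<close> bounding it from above: the
    multipliers \<open>- al g\<close> and \<open>al f\<close> are positive and cancel
    \<open>x v\<close>.\<close>
  define G' where "G' = r ` {g\<in>G. al g = 0} \<union>
    (\<lambda>(f, g). \<lambda>z x. al f * r g z x - al g * r f z x) ` (P \<times> N)"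
  have fin: "finite P" "finite N" using insert.prems(1) by (auto simp: P_def N_def)
  have "(\<exists>x. \<forall>g\<in>G. 0 \<le> g z x) \<longleftrightarrow> (\<exists>x. \<forall>g\<in>G'. 0 \<le> g z x)" for z
  proof
    assume "\<exists>x. \<forall>g\<in>G. 0 \<le> g z x"
    then obtain x where x: "\<And>g. g \<in> G \<Longrightarrow> 0 \<le> al g * x v + r g z x" using al by metis
    have "0 \<le> al f * r g z x - al g * r f z x" if "f \<in> P" "g \<in> N" for f g
    proof -
      have "0 \<le> al f * (al g * x v + r g z x) + (- al g) * (al f * x v + r f z x)"
        by (rule add_nonneg_nonneg; rule mult_nonneg_nonneg; use that x in \<open>auto simp: P_def N_def\<close>)
      then show ?thesis by (simp add: algebra_simps)
    qed
    moreover have "0 \<le> r g z x" if "g \<in> G" "al g = 0" for g using x[OF that(1)] that by simp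
    ultimately show "\<exists>x. \<forall>g\<in>G'. 0 \<le> g z x" by (intro exI[of _ x]) (auto simp: G'_def)
  next
    assume "\<exists>x. \<forall>g\<in>G'. 0 \<le> g z x"
    then obtain x where G': "\<And>g. g \<in> G' \<Longrightarrow> 0 \<le> g z x" by blast
    have x0: "0 \<le> r g z x" if "g \<in> G" "al g = 0" for g
      using that by (intro G') (auto simp: G'_def)
    have "(\<lambda>z x. al f * r g z x - al g * r f z x) \<in> G'" if "f \<in> P" "g \<in> N" for f g
      using that by (force simp: G'_def)
    note x = G'[OF this]
    \<comment> \<open>The pair combinations say that every lower bound on the eliminated variable is
      at most every upper bound, so a common value exists.\<close>
    have "\<exists>y. (\<forall>l\<in>(\<lambda>f. - r f z x / al f) ` P. l \<le> y) \<and> (\<forall>u\<in>(\<lambda>f. - r f z x / al f) ` N. y \<le> u)"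
      using fin x by (intro between_finite_sets) (auto simp: P_def N_def field_simps)
    then obtain y where y: "\<And>f. f \<in> P \<Longrightarrow> - r f z x / al f \<le> y" "\<And>f. f \<in> N \<Longrightarrow> y \<le> - r f z x / al f"
      by auto
    have "0 \<le> al g * y + r g z x" if "g \<in> G" for g
    proof (cases "al g" "0::real" rule: linorder_cases)
      case less
      then show ?thesis using y(2)[of g] that by (simp add: N_def field_simps)
    next
      case equal
      then show ?thesis using x0 that by simp
    next
      case greater
      then show ?thesis using y(1)[of g] that by (simp add: P_def field_simps)
    qed
    \<comment> \<open>The remainders \<open>r g\<close> do not involve \<open>v\<close>, so
      \<open>x\<close> can be changed there without disturbing them.\<close>
    then have "0 \<le> g z (x(v := y))" if "g \<in> G" for g
      using that by (simp add: al[OF that] affine_form_upd[OF r[OF that] insert.hyps(2)])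
    then show "\<exists>x. \<forall>g\<in>G. 0 \<le> g z x" by blast
  qed
  moreover have "closed {z. \<exists>x. \<forall>g\<in>G'. 0 \<le> g z x}"
  proof (rule insert.IH)
    show "finite G'" using fin insert.prems(1) by (simp add: G'_def)
    show "affine_form V g" if "g \<in> G'" for g
      using that by (auto simp: G'_def P_def N_def intro!: affine_form_intros r)
  qed
  ultimately show ?case by simp
qed

section \<open>Feasibility, closedness and attainment for (Balance)\<close>

lemma balance_feasibleD:
  assumes "balance_feasible B lam h p"
  shows "i < narms B \<Longrightarrow> k \<in> states B i \<Longrightarrow> t \<in> brk B i k \<Longrightarrow>
      rew B i k + ffun B i k t * DeltaP B p i k \<le> lam + real t * h i"
    and "lam = (\<Sum>i<narms B. h i)" "0 \<le> lam" "i < narms B \<Longrightarrow> 0 \<le> h i"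
  using assms unfolding balance_feasible_def by auto

text \<open>With \<open>p\<close> constant zero all \<open>DeltaP\<close> vanish, and
  \<open>M\<close>, the sum of all rewards, dominates each single one. Taking \<open>h\<close> equal
  to \<open>M\<close> on every arm forces the value of \<open>lam\<close>.\<close>

lemma balance_feasible_exists:
  assumes B: "monotone_bandit B"
  shows "\<exists>lam h p. balance_feasible B lam h p"
proof -
  define M where "M = (\<Sum>i<narms B. \<Sum>k\<in>states B i. rew B i k)"
  have rew: "0 \<le> rew B i k" if "i < narms B" "k \<in> states B i" for i k
    using monotone_banditD(4)[OF B that] .
  then have M0: "0 \<le> M" unfolding M_def by (auto intro!: sum_nonneg)
  have "rew B i k \<le> real (narms B) * M + real t * M"
    if "i < narms B" "k \<in> states B i" "t \<in> brk B i k" for i k t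
  proof -
    have "rew B i k \<le> (\<Sum>k\<in>states B i. rew B i k)"
      using rew that monotone_banditD(1)[OF B] by (intro member_le_sum) auto
    also have "\<dots> \<le> M" unfolding M_def
      using that rew by (intro member_le_sum[of i "{..<narms B}" "\<lambda>i. \<Sum>k\<in>states B i. rew B i k"])
        (auto intro!: sum_nonneg)
    also have "\<dots> \<le> real t * M" using M0 brkD(3)[OF B that] by (simp add: mult_le_cancel_right1)
    finally show ?thesis using M0 by (simp add: add_increasing)
  qed
  then have "balance_feasible B (real (narms B) * M) (\<lambda>_. M) (\<lambda>_ _. 0)"
    using M0 unfolding balance_feasible_def DeltaP_def by auto
  then show ?thesis by blast
qed

text \<open>The attainable values of \<open>lam\<close> are the projection of a polyhedron, hence
  closed although the variables \<open>p\<close> are unbounded.\<close>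

lemma closed_balance_feasible:
  assumes B: "monotone_bandit B"
  shows "closed {lam. \<exists>h p. balance_feasible B lam h p}"
proof -
  let ?n = "narms B"
  define V :: "(nat + nat \<times> 'a) set" where
    "V = Inl ` {..<?n} \<union> Inr ` (SIGMA i:{..<?n}. states B i)"
  let ?p = "\<lambda>x :: nat + nat \<times> 'a \<Rightarrow> real. \<lambda>i k. x (Inr (i, k))"
  \<comment> \<open>The variables \<open>h i\<close> are coded as \<open>Inl i\<close> and
    \<open>p i k\<close> as \<open>Inr (i, k)\<close>; the equation for \<open>lam\<close> becomes
    two opposite inequalities.\<close>
  define G :: "(real \<Rightarrow> (nat + nat \<times> 'a \<Rightarrow> real) \<Rightarrow> real) set" where
    "G = {\<lambda>z x. z - (\<Sum>i<?n. x (Inl i)), \<lambda>z x. (\<Sum>i<?n. x (Inl i)) - z, \<lambda>z x. z}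
      \<union> (\<lambda>i z x. x (Inl i)) ` {..<?n}
      \<union> (\<Union>i<?n. \<Union>k\<in>states B i. (\<lambda>t z x. (z + real t * x (Inl i))
           - (rew B i k + ffun B i k t * DeltaP B (?p x) i k)) ` brk B i k)"
  have V: "finite V" unfolding V_def using monotone_banditD(1)[OF B] by auto
  have "finite G" unfolding G_def using monotone_banditD(1)[OF B] brkD(1)[OF B] by auto
  moreover have "affine_form V g" if "g \<in> G" for g
    using that unfolding G_def DeltaP_def
    by (auto intro!: affine_form_intros V) (auto simp: V_def)
  ultimately have "closed {z. \<exists>x. \<forall>g\<in>G. 0 \<le> g z x}" by (rule closed_projection[OF V])
  moreover have "(\<exists>x. \<forall>g\<in>G. 0 \<le> g z x) \<longleftrightarrow> (\<exists>h p. balance_feasible B z h p)" for z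
  proof -
    have *: "(\<forall>g\<in>G. 0 \<le> g z x) \<longleftrightarrow> balance_feasible B z (\<lambda>i. x (Inl i)) (?p x)" for x
      unfolding G_def balance_feasible_def by (auto simp: ball_Un image_iff)
    have "balance_feasible B z h p \<longleftrightarrow> (\<forall>g\<in>G. 0 \<le> g z (case_sum h (\<lambda>(i, k). p i k)))" for h p
      unfolding * by simp
    then show ?thesis using * by blast
  qed
  ultimately show ?thesis by simp
qed

text \<open>The equation for \<open>lam\<close> turns the objective into \<open>2 * lam\<close>, and
  a nonempty closed set bounded below contains its infimum.\<close>

lemma balance_optimal_exists:
  assumes B: "monotone_bandit B"
  shows "\<exists>lam h p. balance_optimal B lam h p"
proof -
  let ?Z = "{lam. \<exists>h p. balance_feasible B lam h p}"
  have bdd: "bdd_below ?Z" using balance_feasibleD(3) by (intro bdd_belowI[of _ 0]) auto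
  have "Inf ?Z \<in> ?Z"
    using balance_feasible_exists[OF B] bdd closed_balance_feasible[OF B]
    by (intro closed_contains_Inf) auto
  then obtain h p where f: "balance_feasible B (Inf ?Z) h p" by blast
  have "Inf ?Z + (\<Sum>i<narms B. h i) \<le> lam' + (\<Sum>i<narms B. h' i)"
    if "balance_feasible B lam' h' p'" for lam' h' p'
  proof -
    have "Inf ?Z \<le> lam'" using that bdd by (intro cInf_lower) auto
    then show ?thesis using balance_feasibleD(2)[OF that] balance_feasibleD(2)[OF f] by linarith
  qed
  then show ?thesis using f unfolding balance_optimal_def by blast
qed

subsection \<open>Arms with an untight state\<close>

lemma finite_pos_lower_bound:
  fixes s :: "'a \<Rightarrow> real"
  assumes "finite A" "\<And>a. a \<in> A \<Longrightarrow> 0 < s a"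
  shows "\<exists>e>0. \<forall>a\<in>A. e < s a"
  using assms
proof (induction A)
  case empty
  then show ?case by (auto intro: exI[of _ 1])
next
  case (insert a A)
  then obtain e where "e > 0" "\<forall>a\<in>A. e < s a" by auto
  then show ?case using insert.prems[of a] by (intro exI[of _ "min e (s a / 2)"]) auto
qed

lemma rtrancl_leaves_set:
  assumes "(a, b) \<in> r\<^sup>*" "a \<in> A" "b \<notin> A"
  shows "\<exists>x y. (x, y) \<in> r \<and> x \<in> A \<and> y \<notin> A"
  using assms by (induction rule: rtrancl_induct) auto

text \<open>Moving weight from \<open>lam\<close> and \<open>h i\<close> to the other arms would decrease the objective.\<close>

lemma balance_optimal_not_all_slack:
  assumes B: "monotone_bandit B" and i: "i < narms B" "0 < h i"
    and feas: "balance_feasible B lam h p"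
    and slack: "\<And>k t. k \<in> states B i \<Longrightarrow> t \<in> brk B i k \<Longrightarrow> \<not> tight B lam h p i k t"
  shows "\<exists>lam' h'. balance_feasible B lam' h' p \<and> lam' < lam"
proof -
  let ?n = "narms B"
  \<comment> \<open>The shift by \<open>d\<close> below reduces the slack at time \<open>t\<close>
    by \<open>d\<close> through \<open>lam\<close> and by \<open>t * n * d\<close> through
    \<open>h i\<close>; the quotient is the shift that would exhaust the slack.\<close>
  define s where "s = (\<lambda>(k, t). (lam + real t * h i - (rew B i k + ffun B i k t * DeltaP B p i k))
      / (1 + real t * real ?n))"
  have "0 < s x" if X: "x \<in> (SIGMA k:states B i. brk B i k)" for x
  proof -
    obtain k t where x: "x = (k, t)" "k \<in> states B i" "t \<in> brk B i k" using X by auto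
    have "rew B i k + ffun B i k t * DeltaP B p i k < lam + real t * h i"
      using balance_feasibleD(1)[OF feas i(1) x(2,3)] slack[OF x(2,3)] unfolding tight_def by simp
    then show ?thesis unfolding s_def x(1) prod.case
      by (intro divide_pos_pos add_pos_nonneg) auto
  qed
  then obtain e where e: "0 < e" "\<And>x. x \<in> (SIGMA k:states B i. brk B i k) \<Longrightarrow> e < s x"
    using finite_pos_lower_bound[of "SIGMA k:states B i. brk B i k" s]
      monotone_banditD(1)[OF B i(1)] brkD(1)[OF B i(1)] by blast
  define d where "d = min e (h i / real ?n)"
  \<comment> \<open>Arm \<open>i\<close> gives up \<open>n * d\<close> and the other
    \<open>n - 1\<close> arms receive \<open>d\<close> each, so the total falls by exactly
    \<open>d\<close>, like \<open>lam\<close>.\<close>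
  define h' where "h' = (\<lambda>l. if l = i then h i - real ?n * d else h l + d)"
  have n: "1 \<le> real ?n" using i by simp
  have d: "0 < d" using e i unfolding d_def by auto
  have "real ?n * d \<le> h i" using n unfolding d_def by (auto simp: min_def field_simps)
  moreover have "d \<le> real ?n * d" using n d by simp
  ultimately have hi: "real ?n * d \<le> h i" "d \<le> h i" by auto
  have "h i \<le> lam"
    using balance_feasibleD(2,4)[OF feas] i member_le_sum[of i "{..<?n}" h] by auto
  have "(\<Sum>l<?n. h' l) = h' i + (\<Sum>l\<in>{..<?n} - {i}. h' l)" using i by (intro sum.remove) auto
  also have "(\<Sum>l\<in>{..<?n} - {i}. h' l) = (\<Sum>l\<in>{..<?n} - {i}. h l + d)"
    unfolding h'_def by (intro sum.cong) auto
  also have "\<dots> = (\<Sum>l\<in>{..<?n} - {i}. h l) + (real ?n - 1) * d"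
    using i by (simp add: sum.distrib of_nat_diff)
  also have "(\<Sum>l\<in>{..<?n} - {i}. h l) = lam - h i"
    using balance_feasibleD(2)[OF feas] i by (simp add: sum_diff1)
  finally have sum: "(\<Sum>l<?n. h' l) = lam - d" unfolding h'_def by (simp add: algebra_simps)
  have "rew B l k + ffun B l k t * DeltaP B p l k \<le> lam - d + real t * h' l"
    if l: "l < ?n" "k \<in> states B l" "t \<in> brk B l k" for l k t
  proof (cases "l = i")
    case True
    have "d < s (k, t)" using e(2)[of "(k, t)"] l True unfolding d_def by auto
    moreover have "0 < 1 + real t * real ?n" by (intro add_pos_nonneg) auto
    ultimately have "d * (1 + real t * real ?n) <
        lam + real t * h i - (rew B i k + ffun B i k t * DeltaP B p i k)"
      unfolding s_def by (simp add: pos_less_divide_eq)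
    then show ?thesis unfolding h'_def True by (simp add: algebra_simps)
  next
    case False
    \<comment> \<open>Breakpoints are at least 1, so the increase through \<open>h l\<close> pays
      for the decrease of \<open>lam\<close>.\<close>
    have "d \<le> real t * d" using d brkD(3)[OF B l] by simp
    then show ?thesis using balance_feasibleD(1)[OF feas l] False unfolding h'_def
      by (simp add: algebra_simps)
  qed
  moreover have "0 \<le> h' l" if "l < ?n" for l
    using hi d balance_feasibleD(4)[OF feas that] unfolding h'_def by auto
  ultimately have "balance_feasible B (lam - d) h' p"
    using sum hi \<open>h i \<le> lam\<close> unfolding balance_feasible_def by auto
  then show ?thesis using d by (intro exI[of _ "lam - d"] exI[of _ h']) auto
qed

lemma DeltaP_decrease:
  fixes p :: "nat \<Rightarrow> 's \<Rightarrow> real" and e :: real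
  assumes "monotone_bandit B" "i < narms B" "k \<in> states B i"
  defines "p' \<equiv> p(i := (p i)(k := p i k - e))"
  shows "DeltaP B p' i k = DeltaP B p i k + e * (\<Sum>j\<in>states B i - {k}. qfun B i k j)"
    and "l \<in> states B i \<Longrightarrow> l \<noteq> k \<Longrightarrow> DeltaP B p' i l = DeltaP B p i l - e * qfun B i l k"
    and "i' \<noteq> i \<Longrightarrow> DeltaP B p' i' l = DeltaP B p i' l"
proof -
  let ?S = "states B i"
  show "DeltaP B p' i k = DeltaP B p i k + e * (\<Sum>j\<in>?S - {k}. qfun B i k j)"
    unfolding DeltaP_def p'_def sum_distrib_left sum.distrib[symmetric]
    by (intro sum.cong) (auto simp: algebra_simps)
  show "DeltaP B p' i l = DeltaP B p i l - e * qfun B i l k" if l: "l \<in> ?S" "l \<noteq> k"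
  proof -
    have fin: "finite (?S - {l})" "k \<in> ?S - {l}"
      using monotone_banditD(1)[OF assms(1,2)] l assms(3) by auto
    have "(\<Sum>j\<in>?S - {l} - {k}. qfun B i l j * (p' i j - p' i l)) =
        (\<Sum>j\<in>?S - {l} - {k}. qfun B i l j * (p i j - p i l))"
      using l by (intro sum.cong) (auto simp: p'_def)
    then show ?thesis unfolding DeltaP_def
      by (subst (1 2) sum.remove[OF fin]) (use l in \<open>auto simp: p'_def algebra_simps\<close>)
  qed
  show "i' \<noteq> i \<Longrightarrow> DeltaP B p' i' l = DeltaP B p i' l" unfolding DeltaP_def p'_def by simp
qed

text \<open>
  Lowering \<open>p i k\<close> at a slack state \<open>k\<close> makes its predecessors slack too, unless a predecessor
  cannot move at all. By strong connectivity all constraints of the arm become slack eventually.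
\<close>

lemma untight_arm_absorbing_state:
  assumes B: "monotone_bandit B" and opt: "balance_optimal B lam h p" and i: "untight_arm B lam h p i"
  shows "\<exists>j\<in>states B i. ffun B i j 1 = 0 \<and> rew B i j = lam + h i"
proof (rule ccontr)
  let ?S = "states B i"
  assume no: "\<not> ?thesis"
  have n: "i < narms B" "0 < h i" using i unfolding untight_arm_def by auto
  note M = monotone_banditD[OF B n(1)]
  define N where "N = (\<lambda>p. {k\<in>?S. \<exists>t\<in>brk B i k. tight B lam h p i k t})"
  define P where "P = (\<lambda>p. balance_feasible B lam h p \<and> N p \<noteq> ?S)"
  have "P p" using opt i unfolding P_def N_def balance_optimal_def untight_arm_def by auto
  \<comment> \<open>With \<open>lam\<close> and \<open>h\<close> fixed, \<open>p\<close> is chosen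
    with the fewest states that have a tight constraint; a still smaller number gives the
    contradiction.\<close>
  then obtain p where p: "P p" and min: "\<And>p'. P p' \<Longrightarrow> card (N p) \<le> card (N p')"
    using ex_has_least_nat[of P p "\<lambda>p. card (N p)"] by blast
  then have feas: "balance_feasible B lam h p" and NS: "N p \<noteq> ?S" unfolding P_def by auto
  have NsubS: "N p' \<subseteq> ?S" for p' unfolding N_def by auto
  note F = balance_feasibleD[OF feas]
  have "N p \<noteq> {}"
  proof
    assume "N p = {}"
    then obtain lam' h' where f': "balance_feasible B lam' h' p" and "lam' < lam"
      using balance_optimal_not_all_slack[OF B n feas] unfolding N_def by blast
    then have "lam' + (\<Sum>i<narms B. h' i) < lam + (\<Sum>i<narms B. h i)"
      using balance_feasibleD(2)[OF f'] F(2) by linarith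
    then show False using opt f' unfolding balance_optimal_def by (meson not_le)
  qed
  then obtain j0 k0 where "j0 \<in> N p" "k0 \<in> ?S" "k0 \<notin> N p" using NS NsubS by blast
  moreover from this have "(j0, k0) \<in> {(a, b). a \<in> ?S \<and> b \<in> ?S \<and> 0 < qfun B i a b}\<^sup>*"
    using M(3) NsubS unfolding strongly_connected_def by blast
  \<comment> \<open>Strong connectivity yields an edge from a tight state \<open>j\<close> to a
    slack state \<open>k\<close>; lowering \<open>p i k\<close> will make \<open>j\<close>
    slack.\<close>
  ultimately obtain j k where j: "j \<in> N p" "j \<in> ?S" and k: "k \<in> ?S" "k \<notin> N p"
    and q: "0 < qfun B i j k"
    using rtrancl_leaves_set[of j0 k0 _ "N p"] by blast
  have jk: "j \<noteq> k" using j k by auto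
  have "0 < lam + real t * h i - (rew B i k + ffun B i k t * DeltaP B p i k)" if "t \<in> brk B i k" for t
    using F(1)[OF n(1) k(1) that] k that unfolding N_def tight_def by auto
  \<comment> \<open>Lowering \<open>p i k\<close> by \<open>e\<close> raises
    \<open>f * DeltaP\<close> at \<open>k\<close> by at most \<open>e\<close>, since
    \<open>f\<close> and the total outflow are at most 1; so \<open>k\<close> remains slack.\<close>
  then obtain e where e: "0 < e"
    "\<And>t. t \<in> brk B i k \<Longrightarrow> e < lam + real t * h i - (rew B i k + ffun B i k t * DeltaP B p i k)"
    using finite_pos_lower_bound[OF brkD(1)[OF B n(1) k(1)],
        of "\<lambda>t. lam + real t * h i - (rew B i k + ffun B i k t * DeltaP B p i k)"] by blast
  define p' where "p' = p(i := (p i)(k := p i k - e))"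
  note D = DeltaP_decrease[OF B n(1) k(1), where p = p and e = e, folded p'_def]
  have f0: "0 \<le> ffun B i l t" "ffun B i l t \<le> 1" if "l \<in> ?S" "t \<in> brk B i l" for l t
    using M(7,8)[OF that(1)] brkD(3)[OF B n(1) that] by auto
  have slack_k: "rew B i k + ffun B i k t * DeltaP B p' i k < lam + real t * h i"
    if t: "t \<in> brk B i k" for t
  proof -
    let ?Q = "\<Sum>j\<in>?S - {k}. qfun B i k j"
    have "0 \<le> ?Q" "?Q \<le> 1" using M(5,6)[OF k(1)] by (auto intro: sum_nonneg)
    then have "ffun B i k t * ?Q \<le> 1" using f0[OF k(1) t] by (intro mult_le_one) auto
    then have "e * (ffun B i k t * ?Q) \<le> e" using e(1) by simp
    then show ?thesis using e(2)[OF t] unfolding D(1) by (simp add: algebra_simps)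
  qed
  have other: "rew B i l + ffun B i l t * DeltaP B p' i l =
      rew B i l + ffun B i l t * DeltaP B p i l - ffun B i l t * (e * qfun B i l k)"
    "0 \<le> ffun B i l t * (e * qfun B i l k)"
    if l: "l \<in> ?S" "l \<noteq> k" "t \<in> brk B i l" for l t
    unfolding D(2)[OF l(1,2)] using f0[OF l(1,3)] e(1) M(5)[OF l(1), of k] k(1) l(2)
    by (auto simp: algebra_simps)
  have slack_j: "rew B i j + ffun B i j t * DeltaP B p' i j < lam + real t * h i"
    if t: "t \<in> brk B i j" for t
  proof (cases "ffun B i j t = 0")
    case False
    then have "0 < ffun B i j t * (e * qfun B i j k)" using f0[OF j(2) t] q e(1) by simp
    then show ?thesis using other[OF j(2) jk t] F(1)[OF n(1) j(2) t] by linarith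
  next
    \<comment> \<open>By monotonicity \<open>f\<close> also vanishes at 1. The reward of
      \<open>j\<close> is not \<open>lam + h i\<close> by assumption, so it lies strictly below, and
      the right-hand side only grows with \<open>t\<close>.\<close>
    case True
    have t1: "1 \<le> t" using brkD(3)[OF B n(1) j(2) t] .
    then have "ffun B i j 1 = 0"
      using ffun_mono[OF B n(1) j(2), of 1 t] M(7)[OF j(2), of 1] True by auto
    then have "rew B i j < lam + h i"
      using F(1)[OF n(1) j(2) brkD(2)[OF B n(1) j(2)]] no j(2) by force
    moreover have "h i \<le> real t * h i" using t1 n(2) by simp
    ultimately show ?thesis using True by simp
  qed
  have "rew B a l + ffun B a l t * DeltaP B p' a l \<le> lam + real t * h a"
    if "a < narms B" "l \<in> states B a" "t \<in> brk B a l" for a l t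
  proof (cases "a = i")
    case True
    then show ?thesis
      using slack_k[of t] other[of l t] F(1)[OF that] that by (cases "l = k") auto
  next
    case False
    then show ?thesis using D(3)[OF False] F(1)[OF that] by simp
  qed
  then have feas': "balance_feasible B lam h p'" using feas unfolding balance_feasible_def by auto
  \<comment> \<open>No state turns tight: \<open>k\<close> keeps positive slack and the others never
    lose any, while \<open>j\<close> is no longer tight.\<close>
  have "N p' \<subseteq> N p - {j}"
  proof
    fix l assume "l \<in> N p'"
    then obtain t where l: "l \<in> ?S" "t \<in> brk B i l" "tight B lam h p' i l t" unfolding N_def by auto
    then have "l \<noteq> k" "l \<noteq> j" using slack_k slack_j unfolding tight_def by force+
    moreover have "tight B lam h p i l t"
      using l other[OF l(1) \<open>l \<noteq> k\<close> l(2)] F(1)[OF n(1) l(1,2)] unfolding tight_def by linarith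
    ultimately show "l \<in> N p - {j}" using l unfolding N_def by auto
  qed
  moreover have "finite (N p)" using NsubS M(1) finite_subset by blast
  ultimately have "card (N p') < card (N p)" "N p' \<noteq> ?S"
    using j(1,2) by (auto intro!: psubset_card_mono)
  then show False using min[of p'] feas' unfolding P_def by auto
qed

text \<open>Ensures that the guarantee is not vacuous. Case A needs an argument, because the policy
  must actually achieve \<open>lam + h i\<close>.\<close>

lemma balanced_index_exists:
  assumes B: "monotone_bandit B" and opt: "balance_optimal B lam h p"
  shows "\<exists>\<pi>. balanced_index B lam h p \<pi>"
proof (cases "\<exists>i. untight_arm B lam h p i")
  case True
  then obtain i where i: "untight_arm B lam h p i" by blast
  then have n: "i < narms B" unfolding untight_arm_def by auto
  obtain j where j: "j \<in> states B i" "ffun B i j 1 = 0" "rew B i j = lam + h i"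
    using untight_arm_absorbing_state[OF B opt i] by blast
  \<comment> \<open>Started in \<open>j\<close> with elapsed time 1, arm \<open>i\<close> never
    moves, and each play resets the elapsed time to 1, so every step pays
    \<open>lam + h i\<close>.\<close>
  define \<pi> where "\<pi> = \<lparr>start = \<lambda>l. if l = i then j else (SOME k. k \<in> states B l),
    act = \<lambda>_ _. return_pmf (Some i)\<rparr>"
  have \<pi>: "\<pi> \<in> policies B"
    using j(1) n monotone_banditD(2)[OF B] unfolding policies_def \<pi>_def
    by (auto simp: some_in_eq)
  have *: "fst c i = j \<and> snd c i = 1" if "(H, c) \<in> set_pmf (run B \<pi> T)" for T H c
  proof -
    have "valid_config B c \<and> fst c i = j \<and> snd c i = 1"
      using B \<pi> that
    proof (induction rule: run_induct)
      case (step T H c a c')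
      obtain s \<tau> where c: "c = (s, \<tau>)" by (cases c)
      have "set_pmf (move B i j 1) \<subseteq> {j}"
        using pmf_move[OF B n j(1), of 1] j(2) by (auto simp: set_pmf_eq)
      then show ?case using step by (auto simp: \<pi>_def c)
    qed (simp add: \<pi>_def)
    then show ?thesis by blast
  qed
  have "ereal (lam + h i) \<le> avg_reward_lower B \<pi>"
  proof (rule avg_reward_lower_ge[OF B \<pi>, of "\<lambda>_ _. 0" _ 0])
    fix T H c a assume "(H, c) \<in> set_pmf (run B \<pi> T)" "a \<in> set_pmf (act \<pi> H c)"
    then show "0 + (lam + h i) \<le> step_reward B (c, a) + measure_pmf.expectation (step B c a) (\<lambda>_. 0)"
      using *[of H c T] j(3) by (cases c) (auto simp: \<pi>_def)
  qed simp
  moreover have "\<forall>H c. act \<pi> H c = return_pmf (Some i)" by (simp add: \<pi>_def)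
  ultimately have "balanced_index B lam h p \<pi>"
    using True i n \<pi> unfolding balanced_index_def by auto
  then show ?thesis by blast
next
  case False
  define \<pi> where "\<pi> = \<lparr>start = \<lambda>l. (SOME k. k \<in> states B l),
    act = \<lambda>H c. return_pmf (SOME a. a \<in> index_choices B lam h p H c)\<rparr>"
  have ne: "index_choices B lam h p H c \<noteq> {}" for H c unfolding index_choices_def by auto
  have sub: "index_choices B lam h p H c \<subseteq> insert None (Some ` {..<narms B})" for H c
    unfolding index_choices_def exploitable_arms_def ready_arms_def remaining_arms_def by auto
  have mem: "(SOME a. a \<in> index_choices B lam h p H c) \<in> index_choices B lam h p H c" for H c
    using ne some_in_eq by blast
  have "(SOME a. a \<in> index_choices B lam h p H c) \<in> insert None (Some ` {..<narms B})" for H c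
    using mem sub by blast
  then have "\<pi> \<in> policies B"
    using monotone_banditD(2)[OF B] unfolding policies_def \<pi>_def by (simp add: some_in_eq)
  then show ?thesis using False mem unfolding balanced_index_def by (auto simp: \<pi>_def)
qed

subsection \<open>Weak duality\<close>

text \<open>
  At every time \<open>f\<close> is a convex combination of its values at breakpoints around that time, so the
  constraints extend from the breakpoints to all times.
\<close>

lemma balance_constraint_all_times:
  assumes B: "monotone_bandit B" and feas: "balance_feasible B lam h p"
    and i: "i < narms B" and k: "k \<in> states B i" and t: "1 \<le> t"
  shows "rew B i k + ffun B i k t * DeltaP B p i k \<le> lam + real t * h i"
proof -
  let ?W = "brk B i k" and ?f = "ffun B i k" and ?D = "DeltaP B p i k"
  note W = brkD[OF B i k]
  note F = balance_feasibleD(1)[OF feas i k]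
  have pl: "\<And>a b t. a \<in> ?W \<Longrightarrow> b \<in> ?W \<Longrightarrow> a < b \<Longrightarrow> {a<..<b} \<inter> ?W = {} \<Longrightarrow> t \<in> {a..b} \<Longrightarrow>
      ?f t = ?f a + (?f b - ?f a) * (real t - real a) / (real b - real a)"
    and beyond: "\<And>t. Max ?W \<le> t \<Longrightarrow> ?f t = ?f (Max ?W)"
    using monotone_banditD(9)[OF B i k] unfolding piecewise_linear_on_def by blast+
  have hi: "0 \<le> h i" using balance_feasibleD(4)[OF feas i] .
  show ?thesis
  proof (cases "Max ?W \<le> t")
    \<comment> \<open>Past the last breakpoint \<open>f\<close> is constant, while the right-hand
      side cannot decrease because \<open>h i\<close> is nonnegative.\<close>
    case True
    have "Max ?W \<in> ?W" using W by (intro Max_in) auto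
    from F[OF this] have "rew B i k + ?f t * ?D \<le> lam + real (Max ?W) * h i"
      using beyond[OF True] by simp
    also have "\<dots> \<le> lam + real t * h i" using True hi by (simp add: mult_right_mono)
    finally show ?thesis .
  next
    case False
    define a b where "a = Max {w\<in>?W. w \<le> t}" and "b = Min {w\<in>?W. t < w}"
    have fin: "finite {w\<in>?W. w \<le> t}" "finite {w\<in>?W. t < w}" using W(1) by auto
    have "a \<in> {w\<in>?W. w \<le> t}" unfolding a_def using fin W(2) t by (intro Max_in) auto
    moreover have "Max ?W \<in> ?W" using W by (intro Max_in) auto
    then have "b \<in> {w\<in>?W. t < w}" unfolding b_def using fin False by (intro Min_in) auto
    ultimately have ab: "a \<in> ?W" "a \<le> t" "b \<in> ?W" "t < b" by auto
    have "w \<le> a \<or> b \<le> w" if "w \<in> ?W" for w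
      using that fin unfolding a_def b_def by (cases "w \<le> t") auto
    then have "{a<..<b} \<inter> ?W = {}" by fastforce
    note lin = pl[OF ab(1,3) _ this, of t]
    \<comment> \<open>The interpolation weight of \<open>b\<close>, valid for the time
      \<open>t\<close> and for the value of \<open>f\<close> alike.\<close>
    define c where "c = (real t - real a) / (real b - real a)"
    have c: "0 \<le> c" "c \<le> 1" using ab unfolding c_def by (auto simp: field_simps)
    have "?f t = ?f a + (?f b - ?f a) * c" using lin ab unfolding c_def by simp
    then have ft: "?f t = (1 - c) * ?f a + c * ?f b" by (simp add: algebra_simps)
    have "c * (real b - real a) = real t - real a" using ab unfolding c_def by simp
    then have tt: "real t = (1 - c) * real a + c * real b" by (simp add: algebra_simps)
    have "(1 - c) * (rew B i k + ?f a * ?D) + c * (rew B i k + ?f b * ?D) \<le>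
        (1 - c) * (lam + real a * h i) + c * (lam + real b * h i)"
      by (rule add_mono; rule mult_left_mono; use c F[OF ab(1)] F[OF ab(3)] in simp)
    then show ?thesis unfolding ft tt by (simp add: algebra_simps)
  qed
qed

lemma sum_fun_upd_remove:
  fixes F :: "nat \<Rightarrow> 'a \<Rightarrow> nat \<Rightarrow> real"
  assumes "finite A" "i \<in> A"
  shows "(\<Sum>l\<in>A. F l ((s(i := j)) l) ((\<tau>(i := u)) l)) =
    F i j u + (\<Sum>l\<in>A - {i}. F l (s l) (\<tau> l))"
proof -
  have "(\<Sum>l\<in>A - {i}. F l ((s(i := j)) l) ((\<tau>(i := u)) l)) = (\<Sum>l\<in>A - {i}. F l (s l) (\<tau> l))"
    by (intro sum.cong) auto
  then show ?thesis by (subst sum.remove[OF assms]) simp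
qed

text \<open>For a play, reward plus drift of \<open>p\<close> is at most
  \<open>lam + \<tau> i * h i\<close>. Resetting the elapsed time leaves one \<open>h i\<close> of
  the last term, and the ageing of the other arms completes it to \<open>lam\<close>.\<close>

lemma policy_reward_upper_bound:
  assumes B: "monotone_bandit B" and feas: "balance_feasible B lam h p" and \<pi>: "\<pi> \<in> policies B"
  shows "avg_reward_upper B \<pi> \<le> ereal (2 * lam)"
proof -
  let ?n = "narms B"
  define \<Phi> where "\<Phi> = (\<lambda>c. \<Sum>i<?n. p i (fst c i) + h i * real (snd c i))"
  note F = balance_feasibleD[OF feas]
  have h: "0 \<le> h i * real t" if "i < ?n" for i t using F(4)[OF that] by simp
  show ?thesis
  proof (rule avg_reward_upper_le[OF B \<pi>, of "\<lambda>_. \<Phi>" _ "- (\<Sum>i<?n. \<Sum>k\<in>states B i. \<bar>p i k\<bar>)"])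
    fix T H c a assume HC: "(H, c) \<in> set_pmf (run B \<pi> T)" and a: "a \<in> set_pmf (act \<pi> H c)"
    obtain s \<tau> where c: "c = (s, \<tau>)" by (cases c)
    have v: "valid_config B (s, \<tau>)" using run_valid_config[OF B \<pi> HC] unfolding c .
    show "step_reward B (c, a) + measure_pmf.expectation (step B c a) \<Phi> \<le> \<Phi> c + 2 * lam"
      using policiesD[OF \<pi> a]
    proof (elim disjE exE conjE)
      assume "a = None"
      then show ?thesis using F(2,3)
        by (simp add: c \<Phi>_def sum.distrib algebra_simps)
    next
      fix i assume i: "i < ?n" "a = Some i"
      have si: "s i \<in> states B i" "1 \<le> \<tau> i" using v i unfolding valid_config_def by auto
      \<comment> \<open>The elapsed time of arm \<open>i\<close> is reset to 1 and contributes
        \<open>h i\<close>; the other arms keep their states and age by one step.\<close>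
      define C where "C = h i + (\<Sum>l\<in>{..<?n} - {i}. p l (s l) + h l * real (\<tau> l + 1))"
      have "\<Phi> (s(i := j), (\<lambda>l. \<tau> l + 1)(i := 1)) = p i j + C" for j
        unfolding \<Phi>_def C_def fst_conv snd_conv
        using i by (subst sum_fun_upd_remove[where F = "\<lambda>l k t. p l k + h l * real t"]) auto
      then have "measure_pmf.expectation (step B (s, \<tau>) (Some i)) \<Phi> =
          p i (s i) + ffun B i (s i) (\<tau> i) * DeltaP B p i (s i) + C"
        by (rule expectation_step_play[where s = s and \<tau> = \<tau>, OF B i(1) si])
      moreover have "\<Phi> (s, \<tau>) = p i (s i) + h i * real (\<tau> i) +
          (\<Sum>l\<in>{..<?n} - {i}. p l (s l) + h l * real (\<tau> l))"
        unfolding \<Phi>_def using i by (simp add: sum.remove)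
      moreover have "C = h i + (\<Sum>l\<in>{..<?n} - {i}. p l (s l) + h l * real (\<tau> l)) +
          (\<Sum>l\<in>{..<?n} - {i}. h l)"
        unfolding C_def by (simp add: algebra_simps sum.distrib)
      moreover have "(\<Sum>l\<in>{..<?n} - {i}. h l) = lam - h i" using F(2) i by (simp add: sum_diff1)
      ultimately show ?thesis
        using balance_constraint_all_times[OF B feas i(1) si] unfolding c i(2)
        by (simp add: algebra_simps)
    qed
  next
    fix T H c assume HC: "(H, c) \<in> set_pmf (run B \<pi> T)"
    have v: "valid_config B c" using run_valid_config[OF B \<pi> HC] .
    have "- (\<Sum>k\<in>states B i. \<bar>p i k\<bar>) \<le> p i (fst c i) + h i * real (snd c i)" if "i < ?n" for i
    proof -
      have "\<bar>p i (fst c i)\<bar> \<le> (\<Sum>k\<in>states B i. \<bar>p i k\<bar>)"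
        using v that monotone_banditD(1)[OF B] unfolding valid_config_def
        by (intro member_le_sum[of _ _ "\<lambda>k. \<bar>p i k\<bar>"]) auto
      then show ?thesis using h[OF that, of "snd c i"] by linarith
    qed
    then show "- (\<Sum>i<?n. \<Sum>k\<in>states B i. \<bar>p i k\<bar>) \<le> \<Phi> c"
      unfolding \<Phi>_def sum_negf[symmetric] by (intro sum_mono) auto
  qed
qed

lemma opt_value_le:
  assumes "monotone_bandit B" "balance_feasible B lam h p"
  shows "opt_value B \<le> ereal (2 * lam)"
  unfolding opt_value_def using policy_reward_upper_bound[OF assms] by (rule SUP_least)

subsection \<open>The exploit/explore rule\<close>

context
  fixes B :: "'s bandit" and lam h p
  assumes B: "monotone_bandit B" and feas: "balance_feasible B lam h p"
    and tight: "\<nexists>i. untight_arm B lam h p i"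
begin

section \<open>Tight constraints at the waiting times\<close>

lemma remaining_armsD:
  assumes "i \<in> remaining_arms B h"
  shows "i < narms B" "0 < h i"
  using assms unfolding remaining_arms_def by auto

text \<open>Discarded arms have \<open>h\<close> equal to 0, so one step of waiting credited to each
  remaining arm is worth exactly \<open>lam\<close>.\<close>

lemma lam_eq_sum_remaining: "lam = (\<Sum>i\<in>remaining_arms B h. h i)"
proof -
  have "(\<Sum>i\<in>remaining_arms B h. h i) = (\<Sum>i<narms B. h i)"
    using balance_feasibleD(4)[OF feas]
    by (intro sum.mono_neutral_left) (auto simp: remaining_arms_def order_le_less)
  then show ?thesis using balance_feasibleD(2)[OF feas] by simp
qed

text \<open>As no arm is untight, the \<open>LEAST\<close> in \<open>wait_time\<close> ranges over a
  nonempty set.\<close>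

lemma wait_time_tight:
  assumes "i \<in> remaining_arms B h" "k \<in> states B i"
  shows "wait_time B lam h p i k \<in> brk B i k" "tight B lam h p i k (wait_time B lam h p i k)"
proof -
  have "\<exists>t. t \<in> brk B i k \<and> tight B lam h p i k t"
    using tight assms unfolding untight_arm_def remaining_arms_def by blast
  from LeastI_ex[OF this]
  show "wait_time B lam h p i k \<in> brk B i k" "tight B lam h p i k (wait_time B lam h p i k)"
    unfolding wait_time_def by auto
qed

lemma wait_time_pos:
  assumes "i \<in> remaining_arms B h" "k \<in> states B i"
  shows "1 \<le> wait_time B lam h p i k"
  using brkD(3)[OF B _ assms(2) wait_time_tight(1)[OF assms]] remaining_armsD[OF assms(1)] by simp

text \<open>In a good state \<open>f * DeltaP\<close> does not increase with time while
  \<open>lam + t * h i\<close> strictly increases, so tightness at a later time would violate the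
  constraint at 1.\<close>

lemma wait_time_good_state:
  assumes i: "i \<in> remaining_arms B h" and k: "k \<in> good_states B p i"
  shows "wait_time B lam h p i k = 1"
proof (rule ccontr)
  let ?w = "wait_time B lam h p i k"
  assume "?w \<noteq> 1"
  have kS: "k \<in> states B i" and D: "DeltaP B p i k < 0" using k unfolding good_states_def by auto
  note n = remaining_armsD[OF i]
  have w: "1 < ?w" using wait_time_pos[OF i kS] \<open>?w \<noteq> 1\<close> by simp
  have "ffun B i k ?w * DeltaP B p i k \<le> ffun B i k 1 * DeltaP B p i k"
    using ffun_mono[OF B n(1) kS, of 1 ?w] w D by (intro mult_right_mono_neg) auto
  then have "lam + real ?w * h i \<le> lam + real 1 * h i"
    using wait_time_tight(2)[OF i kS] balance_feasibleD(1)[OF feas n(1) kS brkD(2)[OF B n(1) kS]]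
    unfolding tight_def by linarith
  then show False using w n(2) by simp
qed

lemma play_gain_good:
  assumes i: "i \<in> remaining_arms B h" and k: "k \<in> good_states B p i"
  shows "rew B i k + ffun B i k 1 * DeltaP B p i k = lam + h i"
  using wait_time_tight(2)[OF i, of k] k wait_time_good_state[OF assms]
  unfolding tight_def good_states_def by simp

text \<open>\<open>DeltaP\<close> is nonnegative in a bad state and \<open>f\<close> is monotone, so
  a play after the tight time gains no less than one at it.\<close>

lemma play_gain_bad:
  assumes i: "i \<in> remaining_arms B h" and k: "k \<in> bad_states B p i"
    and t: "wait_time B lam h p i k \<le> t"
  shows "lam + real (wait_time B lam h p i k) * h i \<le> rew B i k + ffun B i k t * DeltaP B p i k"
proof -
  let ?w = "wait_time B lam h p i k"
  have kS: "k \<in> states B i" and D: "0 \<le> DeltaP B p i k"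
    using k unfolding bad_states_def good_states_def by auto
  have "ffun B i k ?w * DeltaP B p i k \<le> ffun B i k t * DeltaP B p i k"
    using ffun_mono[OF B remaining_armsD(1)[OF i] kS wait_time_pos[OF i kS] t] D
    by (intro mult_right_mono) auto
  then show ?thesis using wait_time_tight(2)[OF i kS] unfolding tight_def by linarith
qed

definition played :: "'s history \<Rightarrow> nat set" where
  "played H = {i. Some i \<in> snd ` set H}"

lemma played_Cons: "played ((c, a) # H) = set_option a \<union> played H"
  unfolding played_def by (cases a) auto

lemma index_choices_cases:
  assumes "a \<in> index_choices B lam h p H c"
  obtains (exploit) i where "a = Some i" "i \<in> exploitable_arms B h p c"
      "last_played H \<inter> exploitable_arms B h p c \<noteq> {} \<Longrightarrow> i \<in> last_played H"
    | (explore) i where "a = Some i" "exploitable_arms B h p c = {}" "i \<in> ready_arms B lam h p c"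
    | (idle) "a = None" "exploitable_arms B h p c = {}" "ready_arms B lam h p c = {}"
  using assms unfolding index_choices_def by (auto split: if_splits)

text \<open>Tightness in a good state is known only at elapsed time 1, and delay can hurt since
  \<open>DeltaP\<close> is negative. The invariant therefore says that an exploitable arm was played
  in the previous step or, having started in a good state, was never played.\<close>

definition fresh_exploitable :: "'s history \<Rightarrow> 's config \<Rightarrow> bool" where
  "fresh_exploitable H c \<longleftrightarrow> (\<forall>i\<in>last_played H. snd c i = 1) \<and>
     (\<forall>i\<in>exploitable_arms B h p c. i \<in> last_played H \<or> i \<notin> played H)"

text \<open>An arm enters a good state only by being played, and the rule then stays with it until
  it leaves.\<close>

lemma run_fresh_exploitable:
  assumes \<pi>: "\<pi> \<in> policies B"
    and choice: "\<And>H c. set_pmf (act \<pi> H c) \<subseteq> index_choices B lam h p H c"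
    and HC: "(H, c) \<in> set_pmf (run B \<pi> T)"
  shows "fresh_exploitable H c"
proof -
  have "valid_config B c \<and> fresh_exploitable H c"
    using B \<pi> HC
  proof (induction rule: run_induct)
    case start
    show ?case by (simp add: fresh_exploitable_def played_def)
  next
    case (step T H c a c')
    obtain s \<tau> where c: "c = (s, \<tau>)" by (cases c)
    have "a \<in> index_choices B lam h p H c" using choice step by blast
    then show ?case
    proof (cases rule: index_choices_cases)
      case idle
      then have "exploitable_arms B h p c' = {}"
        using step by (auto simp: c exploitable_arms_def)
      then show ?thesis using idle by (simp add: fresh_exploitable_def)
    next
      case (explore i)
      then have "exploitable_arms B h p c' \<subseteq> {i}" "snd c' i = 1"
        using step by (auto simp: c exploitable_arms_def split: if_splits)
      then show ?thesis using explore by (auto simp: fresh_exploitable_def)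
    next
      case (exploit i)
      then have *: "exploitable_arms B h p c' \<subseteq> insert i (exploitable_arms B h p c)" "snd c' i = 1"
        using step by (auto simp: c exploitable_arms_def split: if_splits)
      have "l = i \<or> l \<notin> played H" if "l \<in> exploitable_arms B h p c" for l
      proof (cases "l \<in> last_played H")
        case True
        then have "i \<in> last_played H" using exploit(3) that by blast
        \<comment> \<open>\<open>last_played\<close> has at most one element, so \<open>l\<close>
          and \<open>i\<close> coincide.\<close>
        then show ?thesis using True by (cases H rule: last_played.cases) auto
      next
        case False
        then show ?thesis using step that unfolding fresh_exploitable_def by blast
      qed
      then show ?thesis using exploit(1) * by (auto simp: fresh_exploitable_def played_Cons)
    qed
  qed
  then show ?thesis by blast
qed

text \<open>
  The potential credits an arm only for its waiting time up to the moment it becomes ready; the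
  last term pays for the first play of an arm that starts in a good state, where the elapsed time
  may exceed \<open>1\<close>.
\<close>

definition index_potential :: "real \<Rightarrow> 's history \<Rightarrow> 's config \<Rightarrow> real" where
  "index_potential K H c =
     (\<Sum>i\<in>remaining_arms B h. p i (fst c i) + h i * real (min (snd c i) (wait_time B lam h p i (fst c i))))
     - K * real (card (remaining_arms B h - played H))"

lemma finite_remaining_arms: "finite (remaining_arms B h)"
  unfolding remaining_arms_def by simp

text \<open>Only an inequality, because the cut-off waiting times of the other arms may or may not
  grow; their growth is discarded.\<close>

lemma expectation_index_potential_play:
  assumes i: "i \<in> remaining_arms B h" and v: "valid_config B (s, \<tau>)" and K: "0 \<le> K"
  shows "index_potential K H (s, \<tau>)
      + ffun B i (s i) (\<tau> i) * DeltaP B p i (s i)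
      + h i * (1 - real (min (\<tau> i) (wait_time B lam h p i (s i))))
      + K * (if i \<in> played H then 0 else 1)
    \<le> measure_pmf.expectation (step B (s, \<tau>) (Some i)) (index_potential K (((s, \<tau>), Some i) # H))"
proof -
  let ?A = "remaining_arms B h" and ?w = "wait_time B lam h p"
  let ?F = "\<lambda>l k t. p l k + h l * real (min t (?w l k))"
  note n = remaining_armsD[OF i]
  have si: "s i \<in> states B i" "1 \<le> \<tau> i" using v n unfolding valid_config_def by auto
  define H' where "H' = ((s, \<tau>), Some i) # H"
  define C where "C = h i + (\<Sum>l\<in>?A - {i}. ?F l (s l) (\<tau> l + 1)) - K * real (card (?A - played H'))"
  have "index_potential K H' (s(i := j), (\<lambda>l. \<tau> l + 1)(i := 1)) = p i j + C"
    if "j \<in> states B i" for j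
  proof -
    \<comment> \<open>Waiting times are at least 1, so after the reset the cut-off term is
      \<open>h i\<close> whatever the new state.\<close>
    have "min 1 (?w i j) = 1" using wait_time_pos[OF i that] by simp
    then show ?thesis unfolding index_potential_def C_def fst_conv snd_conv
      by (subst sum_fun_upd_remove[where F = ?F]) (use finite_remaining_arms i in auto)
  qed
  then have E: "measure_pmf.expectation (step B (s, \<tau>) (Some i)) (index_potential K H') =
      p i (s i) + ffun B i (s i) (\<tau> i) * DeltaP B p i (s i) + C"
    by (rule expectation_step_play[where s = s and \<tau> = \<tau>, OF B n(1) si])
  have \<Phi>: "index_potential K H (s, \<tau>) = ?F i (s i) (\<tau> i) + (\<Sum>l\<in>?A - {i}. ?F l (s l) (\<tau> l))
      - K * real (card (?A - played H))"
    unfolding index_potential_def fst_conv snd_conv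
    by (subst sum.remove[OF finite_remaining_arms i]) simp
  have mono: "(\<Sum>l\<in>?A - {i}. ?F l (s l) (\<tau> l)) \<le> (\<Sum>l\<in>?A - {i}. ?F l (s l) (\<tau> l + 1))"
    using remaining_armsD(2) by (intro sum_mono) (auto intro!: mult_left_mono order.strict_implies_order)
  \<comment> \<open>The number of unplayed arms drops exactly at a first play, which releases the
    reserve \<open>K\<close>.\<close>
  have "?A - played H' = (?A - played H) - {i}" unfolding H'_def by (auto simp: played_Cons)
  then have "card (?A - played H) = card (?A - played H') + (if i \<in> played H then 0 else 1)"
    using finite_remaining_arms i card.remove[of "?A - played H" i] by auto
  then have "K * real (card (?A - played H)) =
      K * real (card (?A - played H')) + K * (if i \<in> played H then 0 else 1)"
    by (auto simp: algebra_simps)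
  then show ?thesis using mono \<Phi> E unfolding C_def H'_def[symmetric] by (simp add: algebra_simps)
qed

text \<open>Tightness gives plays of ready arms and continued exploitation a surplus of at least
  \<open>h i\<close> over \<open>lam\<close>. It need not apply to a first play in a good state,
  which the condition on \<open>K\<close> covers.\<close>

lemma index_policy_drift:
  assumes v: "valid_config B c" and a: "a \<in> index_choices B lam h p H c"
    and fresh: "fresh_exploitable H c"
    and K: "0 \<le> K" "\<And>i k. i \<in> remaining_arms B h \<Longrightarrow> k \<in> states B i \<Longrightarrow> lam - DeltaP B p i k \<le> K"
  shows "index_potential K H c + lam \<le>
    step_reward B (c, a) + measure_pmf.expectation (step B c a) (index_potential K ((c, a) # H))"
proof -
  obtain s \<tau> where c: "c = (s, \<tau>)" by (cases c)
  let ?A = "remaining_arms B h" and ?w = "wait_time B lam h p"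
  have v': "valid_config B (s, \<tau>)" using v unfolding c .
  have sA: "s i \<in> states B i" "1 \<le> \<tau> i" if "i \<in> ?A" for i
    using v' remaining_armsD[OF that] unfolding valid_config_def by auto
  show ?thesis
    using a
  proof (cases rule: index_choices_cases)
    case idle
    \<comment> \<open>No arm is exploitable or ready, so every remaining arm is in a bad state
      strictly before its waiting time and its cut-off time still advances.\<close>
    have "min (\<tau> i + 1) (?w i (s i)) = min (\<tau> i) (?w i (s i)) + 1" if "i \<in> ?A" for i
    proof -
      have "s i \<in> bad_states B p i"
        using idle(2) sA[OF that] that unfolding c exploitable_arms_def bad_states_def by auto
      then have "\<tau> i < ?w i (s i)" using idle(3) that unfolding c ready_arms_def by auto
      then show ?thesis by simp
    qed
    then have "(\<Sum>i\<in>?A. p i (s i) + h i * real (min (\<tau> i + 1) (?w i (s i)))) =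
       (\<Sum>i\<in>?A. p i (s i) + h i * real (min (\<tau> i) (?w i (s i))) + h i)"
      by (intro sum.cong) (auto simp: algebra_simps)
    also have "\<dots> = (\<Sum>i\<in>?A. p i (s i) + h i * real (min (\<tau> i) (?w i (s i)))) + lam"
      by (subst sum.distrib) (simp flip: lam_eq_sum_remaining)
    finally have "(\<Sum>i\<in>?A. p i (s i) + h i * real (min (\<tau> i + 1) (?w i (s i)))) =
       (\<Sum>i\<in>?A. p i (s i) + h i * real (min (\<tau> i) (?w i (s i)))) + lam" .
    then have "index_potential K ((c, a) # H) (s, \<lambda>l. \<tau> l + 1) = index_potential K H c + lam"
      unfolding index_potential_def idle(1) played_Cons c by simp
    then show ?thesis unfolding idle(1) c by simp
  next
    case (explore i)
    then have i: "i \<in> ?A" "s i \<in> bad_states B p i" "?w i (s i) \<le> \<tau> i"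
      unfolding c ready_arms_def by auto
    have "0 \<le> K * (if i \<in> played H then 0 else 1)" using K(1) by simp
    moreover have "min (\<tau> i) (?w i (s i)) = ?w i (s i)" using i(3) by simp
    note expectation_index_potential_play[OF i(1) v' K(1), of H, unfolded this]
    ultimately show ?thesis
      using play_gain_bad[OF i] remaining_armsD(2)[OF i(1)]
      unfolding c explore(1) by (simp add: algebra_simps)
  next
    case (exploit i)
    then have i: "i \<in> ?A" "s i \<in> good_states B p i" unfolding c exploitable_arms_def by auto
    have w: "min (\<tau> i) (?w i (s i)) = 1" using wait_time_good_state[OF i] sA[OF i(1)] by simp
    note E = expectation_index_potential_play[OF i(1) v' K(1), of H, unfolded w]
    have "i \<in> last_played H \<or> i \<notin> played H"
      using fresh exploit(2) unfolding fresh_exploitable_def by blast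
    then show ?thesis
    proof
      assume "i \<in> last_played H"
      then have "\<tau> i = 1" using fresh unfolding fresh_exploitable_def c by auto
      moreover have "0 \<le> K * (if i \<in> played H then 0 else 1)" using K(1) by simp
      ultimately show ?thesis using E play_gain_good[OF i] remaining_armsD(2)[OF i(1)]
        unfolding c exploit(1) by simp
    next
      assume new: "i \<notin> played H"
      have "DeltaP B p i (s i) < 0" using i(2) unfolding good_states_def by simp
      \<comment> \<open>As \<open>f\<close> is at most 1, the play loses at most
        \<open>- DeltaP\<close>, for which \<open>K\<close> pays in addition to
        \<open>lam\<close>.\<close>
      then have "1 * DeltaP B p i (s i) \<le> ffun B i (s i) (\<tau> i) * DeltaP B p i (s i)"
        using monotone_banditD(8)[OF B remaining_armsD(1)[OF i(1)] sA[OF i(1)]]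
        by (intro mult_right_mono_neg) auto
      moreover have "0 \<le> rew B i (s i)"
        using monotone_banditD(4)[OF B remaining_armsD(1)[OF i(1)] sA(1)[OF i(1)]] .
      ultimately show ?thesis using E new K(2)[OF i(1) sA(1)[OF i(1)]]
        unfolding c exploit(1) by simp
    qed
  qed
qed

lemma index_policy_reward_lower_bound:
  assumes \<pi>: "\<pi> \<in> policies B"
    and choice: "\<And>H c. set_pmf (act \<pi> H c) \<subseteq> index_choices B lam h p H c"
  shows "ereal lam \<le> avg_reward_lower B \<pi>"
proof -
  let ?A = "remaining_arms B h" and ?w = "wait_time B lam h p"
  define X where "X = (SIGMA i:?A. states B i)"
  have X: "finite X" unfolding X_def using finite_remaining_arms monotone_banditD(1)[OF B]
      remaining_armsD(1) by (intro finite_SigmaI) auto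
  \<comment> \<open>The sum of absolute values dominates \<open>- DeltaP\<close> for all remaining
    arms and states at once.\<close>
  define K where "K = lam + (\<Sum>(i, k)\<in>X. \<bar>DeltaP B p i k\<bar>)"
  \<comment> \<open>The cut-off at the waiting time keeps the potential bounded above even if an arm
    is left unplayed for long.\<close>
  define M where "M = (\<Sum>i\<in>?A. \<Sum>k\<in>states B i. \<bar>p i k\<bar> + h i * real (?w i k))"
  have K0: "0 \<le> K" unfolding K_def using balance_feasibleD(3)[OF feas]
    by (intro add_nonneg_nonneg sum_nonneg) auto
  have K: "lam - DeltaP B p i k \<le> K" if "i \<in> ?A" "k \<in> states B i" for i k
    using member_le_sum[of "(i, k)" X "\<lambda>(i, k). \<bar>DeltaP B p i k\<bar>"] X that
    unfolding K_def X_def by auto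
  show ?thesis
  proof (rule avg_reward_lower_ge[OF B \<pi>, of "index_potential K" _ M])
    fix T H c a assume HC: "(H, c) \<in> set_pmf (run B \<pi> T)" and a: "a \<in> set_pmf (act \<pi> H c)"
    have "a \<in> index_choices B lam h p H c" using a choice by blast
    then show "index_potential K H c + lam \<le> step_reward B (c, a) +
        measure_pmf.expectation (step B c a) (index_potential K ((c, a) # H))"
      using run_valid_config[OF B \<pi> HC] run_fresh_exploitable[OF \<pi> choice HC] K0 K
      by (intro index_policy_drift) auto
  next
    fix T H c assume HC: "(H, c) \<in> set_pmf (run B \<pi> T)"
    have v: "valid_config B c" using run_valid_config[OF B \<pi> HC] .
    have "p i (fst c i) + h i * real (min (snd c i) (?w i (fst c i))) \<le>
        (\<Sum>k\<in>states B i. \<bar>p i k\<bar> + h i * real (?w i k))" if i: "i \<in> ?A" for i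
    proof -
      note n = remaining_armsD[OF i]
      have "h i * real (min (snd c i) (?w i (fst c i))) \<le> h i * real (?w i (fst c i))"
        using n(2) by (intro mult_left_mono) auto
      then have "p i (fst c i) + h i * real (min (snd c i) (?w i (fst c i))) \<le>
          \<bar>p i (fst c i)\<bar> + h i * real (?w i (fst c i))" by linarith
      also have "\<dots> \<le> (\<Sum>k\<in>states B i. \<bar>p i k\<bar> + h i * real (?w i k))"
        using n v monotone_banditD(1)[OF B n(1)] unfolding valid_config_def
        by (intro member_le_sum[of _ _ "\<lambda>k. \<bar>p i k\<bar> + h i * real (?w i k)"]) auto
      finally show ?thesis .
    qed
    then have "(\<Sum>i\<in>?A. p i (fst c i) + h i * real (min (snd c i) (?w i (fst c i)))) \<le> M"
      unfolding M_def by (intro sum_mono) auto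
    moreover have "0 \<le> K * real (card (?A - played H))" using K0 by simp
    ultimately show "index_potential K H c \<le> M" unfolding index_potential_def by linarith
  qed
qed

end

text \<open>In Case A the definition of the policy already promises \<open>lam + h i\<close> with
  positive \<open>h i\<close>; Case B is the drift argument.\<close>

lemma balanced_index_reward_lower_bound:
  assumes B: "monotone_bandit B" and feas: "balance_feasible B lam h p"
    and \<pi>: "balanced_index B lam h p \<pi>"
  shows "ereal lam \<le> avg_reward_lower B \<pi>"
proof (cases "\<exists>i. untight_arm B lam h p i")
  case True
  then obtain i where "0 < h i" "ereal (lam + h i) \<le> avg_reward_lower B \<pi>"
    using \<pi> unfolding balanced_index_def untight_arm_def by auto
  then show ?thesis by (smt (verit) ereal_less_eq(3) order_trans)
next
  case False
  then show ?thesis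
    using index_policy_reward_lower_bound[OF B feas False] \<pi> unfolding balanced_index_def by auto
qed

theorem theorem5:
  fixes B :: "'s bandit"
  assumes "monotone_bandit B"
  shows "(\<exists>lam h p. balance_optimal B lam h p) \<and>
    (\<forall>lam h p. balance_optimal B lam h p \<longrightarrow>
       (\<exists>\<pi>. balanced_index B lam h p \<pi>) \<and>
       (\<forall>\<pi>. balanced_index B lam h p \<pi> \<longrightarrow> avg_reward_lower B \<pi> \<ge> opt_value B / 2))"
proof (intro conjI allI impI)
  show "\<exists>lam h p. balance_optimal B lam h p" by (rule balance_optimal_exists[OF assms])
next
  fix lam h p assume opt: "balance_optimal B lam h p"
  show "\<exists>\<pi>. balanced_index B lam h p \<pi>" by (rule balanced_index_exists[OF assms opt])
  fix \<pi> assume "balanced_index B lam h p \<pi>"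
  moreover have feas: "balance_feasible B lam h p" using opt unfolding balance_optimal_def by simp
  ultimately have "ereal lam \<le> avg_reward_lower B \<pi>"
    by (intro balanced_index_reward_lower_bound[OF assms])
  moreover have "opt_value B / 2 \<le> ereal (2 * lam) / 2"
    using opt_value_le[OF assms feas] by (rule ereal_divide_right_mono) simp
  ultimately show "opt_value B / 2 \<le> avg_reward_lower B \<pi>" by simp
qed

end
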